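(* Let $(Q,N,C_1,\dots,C_N)$ be a random vector with $N\in\{0,1,2,\dots\}\cup\{\infty\}$, $C_i\ge 0$ for all $i$, and $P(|Q|>0)>0$; let $Z_N=\sum_{i=1}^N C_i$. Suppose $P(Q>x)\in\mathcal{R}_{-\alpha}$ with $\alpha>1$, $E[Z_N^{\alpha+\epsilon}]<\infty$ for some $\epsilon>0$, and let $\rho\vee\rho_\alpha<\eta<1$. Then there exists a constant $K=K(\eta,\epsilon)>0$ (not depending on $n$ or $x$) such that for all $n\ge1$ and all $x\ge1$, $$P(W_n>x)\le K\,\eta^n\,P(Q>x).$$
   Context: The components of $(Q,N,C_1,\dots,C_N)$ may be arbitrarily dependent, and $Q$ is real-valued. When $N=\infty$, sums $\sum_{i=1}^N$ run over all $i\ge1$. The law of $(Q,N,C_1,\dots,C_N)$ is fixed, and constants may depend on it. Weighted branching tree: let $U=\bigcup_{k\ge0}\{1,2,3,\dots\}^k$ be the set of finite sequences of positive integers, with $\emptyset$ the empty sequence (root); for $\mathbf{i}=(i_1,\dots,i_n)\in U$ write $(\mathbf{i},j)=(i_1,\dots,i_n,j)$. To each node $\mathbf{i}$ assign an i.i.d. copy $(Q_{\mathbf i},N_{\mathbf i},C_{(\mathbf i,1)},\dots,C_{(\mathbf i,N_{\mathbf i})})$ of $(Q,N,C_1,\dots,C_N)$, the root's vector being $(Q,N,C_1,\dots,C_N)$ itself. Let $A_0=\{\emptyset\}$ and $A_n=\{(\mathbf i,j):\mathbf i\in A_{n-1},\ 1\le j<N_{\mathbf i}+1\}$ for $n\ge1$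 (the $n$th generation). Set $\Pi_\emptyset=1$ and $\Pi_{(\mathbf i,j)}=C_{(\mathbf i,j)}\Pi_{\mathbf i}$. Define $W_n=\sum_{\mathbf i\in A_n}Q_{\mathbf i}\Pi_{\mathbf i}$ for $n\ge0$ (so $W_0=Q$). Notation: $\rho_\beta=E\left[\sum_{i=1}^N C_i^\beta\right]$ for $\beta>0$, $\rho=\rho_1$, $x\vee y=\max\{x,y\}$. $f\in\mathcal{R}_{-\alpha}$ means $f(x)=x^{-\alpha}L(x)$ for some slowly varying $L$, i.e. $L:[0,\infty)\to(0,\infty)$ with $\lim_{x\to\infty}L(\lambda x)/L(x)=1$ for every $\lambda>0$. *)

theory Defs
  imports "HOL-Probability.Probability"
begin

section \<open>Regular variation at infinity\<close>

definition slowly_varying :: "(real \<Rightarrow> real) \<Rightarrow> bool" where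
  "slowly_varying L \<longleftrightarrow>
     (\<forall>x\<ge>0. L x > 0) \<and> (\<forall>c>0. ((\<lambda>x. L (c * x) / L x) \<longlongrightarrow> 1) at_top)"

definition regularly_varying :: "real \<Rightarrow> (real \<Rightarrow> real) \<Rightarrow> bool" where
  "regularly_varying a f \<longleftrightarrow> (\<exists>L. slowly_varying L \<and> (\<forall>x>0. f x = x powr a * L x))"

section \<open>Powers of extended nonnegative reals\<close>

text \<open>Intended for positive exponents only.\<close>

definition ennreal_powr :: "ennreal \<Rightarrow> real \<Rightarrow> ennreal" where
  "ennreal_powr z p = (if z = \<top> then \<top> else ennreal (enn2real z powr p))"

section \<open>Weighted branching trees\<close>

text \<open>
  Nodes are finite sequences of positive integers. The marks of the tree are
  \<open>Q i \<omega>\<close> and \<open>N i \<omega>\<close> for a node \<open>i\<close>, and \<open>C (i @ [j]) \<omega>\<close> for the weight attached to the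
  \<open>j\<close>-th child of \<open>i\<close>. The values of \<open>C\<close> at the root and at
  children with label beyond \<open>N i \<omega>\<close> are irrelevant.
\<close>

definition tree_nodes :: "nat list set" where
  "tree_nodes = {i. \<forall>j\<in>set i. 1 \<le> j}"

definition offspring :: "enat \<Rightarrow> nat set" where
  "offspring m = {j. 1 \<le> j \<and> enat j < m + 1}"

text \<open>
  The vector \<open>(Q, N, C\<^sub>1, \<dots>, C\<^sub>N)\<close> at node \<open>i\<close> has random length; it is encoded as an element of
  a fixed space by setting all coordinates outside \<open>{1..N}\<close> to zero. Since \<open>N\<close> is itself a
  component, this encoding carries exactly the information in the random vector.
\<close>

definition node_space :: "(real \<times> enat \<times> (nat \<Rightarrow> real)) measure" where
  "node_space = borel \<Otimes>\<^sub>M count_space UNIV \<Otimes>\<^sub>M (\<Pi>\<^sub>M j\<in>UNIV. borel)"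

definition node_vector ::
  "(nat list \<Rightarrow> 'a \<Rightarrow> real) \<Rightarrow> (nat list \<Rightarrow> 'a \<Rightarrow> enat) \<Rightarrow> (nat list \<Rightarrow> 'a \<Rightarrow> real) \<Rightarrow>
     nat list \<Rightarrow> 'a \<Rightarrow> real \<times> enat \<times> (nat \<Rightarrow> real)" where
  "node_vector Q N C i \<omega> =
     (Q i \<omega>, N i \<omega>, \<lambda>j. if j \<in> offspring (N i \<omega>) then C (i @ [j]) \<omega> else 0)"

definition iid_tree ::
  "'a measure \<Rightarrow> (nat list \<Rightarrow> 'a \<Rightarrow> real) \<Rightarrow> (nat list \<Rightarrow> 'a \<Rightarrow> enat) \<Rightarrow>
     (nat list \<Rightarrow> 'a \<Rightarrow> real) \<Rightarrow> bool" where
  "iid_tree M Q N C \<longleftrightarrow>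
     prob_space.indep_vars M (\<lambda>_. node_space) (node_vector Q N C) tree_nodes \<and>
     (\<forall>i\<in>tree_nodes. distr M node_space (node_vector Q N C i) =
                     distr M node_space (node_vector Q N C []))"

primrec generation :: "(nat list \<Rightarrow> 'a \<Rightarrow> enat) \<Rightarrow> nat \<Rightarrow> 'a \<Rightarrow> nat list set" where
  "generation N 0 \<omega> = {[]}"
| "generation N (Suc n) \<omega> = {i @ [j] | i j. i \<in> generation N n \<omega> \<and> j \<in> offspring (N i \<omega>)}"

text \<open>The product of the weights along the path from the root to \<open>i\<close>; \<open>butlast i\<close> is the parent.\<close>

function path_weight :: "(nat list \<Rightarrow> 'a \<Rightarrow> real) \<Rightarrow> nat list \<Rightarrow> 'a \<Rightarrow> real" where
  "path_weight C i \<omega> = (if i = [] then 1 else C i \<omega> * path_weight C (butlast i) \<omega>)"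
  by auto
termination by (relation "Wellfounded.measure (\<lambda>(C, i, \<omega>). length i)") auto

declare path_weight.simps [simp del]

lemma path_weight_Nil [simp]: "path_weight C [] \<omega> = 1"
  by (subst path_weight.simps) simp

lemma path_weight_snoc [simp]: "path_weight C (i @ [j]) \<omega> = C (i @ [j]) \<omega> * path_weight C i \<omega>"
  by (subst path_weight.simps) simp

text \<open>
  \<open>W\<^sub>n = (\<Sum>i\<in>A\<^sub>n. Q\<^sub>i \<Pi>\<^sub>i)\<close>. The generation may be infinite and the terms may have either sign,
  so the sum is taken in the extended reals, as the sum of the positive parts minus the sum of
  the negative parts. Note that \<open>\<infinity> - \<infinity> = \<infinity>\<close> in type \<open>ereal\<close>. The lemma below shows
  that this is the ordinary sum whenever the latter converges unconditionally, and in
  particular whenever the generation is finite.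
\<close>

definition generation_sum ::
  "(nat list \<Rightarrow> 'a \<Rightarrow> real) \<Rightarrow> (nat list \<Rightarrow> 'a \<Rightarrow> enat) \<Rightarrow> (nat list \<Rightarrow> 'a \<Rightarrow> real) \<Rightarrow>
     nat \<Rightarrow> 'a \<Rightarrow> ereal" where
  "generation_sum Q N C n \<omega> =
     enn2ereal (\<Sum>\<^sub>\<infinity>i\<in>generation N n \<omega>. ennreal (Q i \<omega> * path_weight C i \<omega>)) -
     enn2ereal (\<Sum>\<^sub>\<infinity>i\<in>generation N n \<omega>. ennreal (- (Q i \<omega> * path_weight C i \<omega>)))"

lemma infsum_ennreal_max:
  fixes f :: "'i \<Rightarrow> real"
  assumes "f summable_on A"
  shows "(\<lambda>i. max 0 (f i)) summable_on A"
    and "(\<Sum>\<^sub>\<infinity>i\<in>A. ennreal (f i)) = ennreal (\<Sum>\<^sub>\<infinity>i\<in>A. max 0 (f i))"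
proof -
  have "(\<lambda>i. norm (f i)) summable_on A"
    using assms summable_on_iff_abs_summable_on_real by blast
  then show s: "(\<lambda>i. max 0 (f i)) summable_on A"
    by (rule summable_on_comparison_test) auto
  have "((\<lambda>i. max 0 (f i)) has_sum (\<Sum>\<^sub>\<infinity>i\<in>A. max 0 (f i))) A"
    using s by simp
  then have "((\<lambda>F. ennreal (\<Sum>i\<in>F. max 0 (f i))) \<longlongrightarrow> ennreal (\<Sum>\<^sub>\<infinity>i\<in>A. max 0 (f i)))
      (finite_subsets_at_top A)"
    unfolding has_sum_def by (rule tendsto_ennrealI)
  then have "((\<lambda>i. ennreal (f i)) has_sum ennreal (\<Sum>\<^sub>\<infinity>i\<in>A. max 0 (f i))) A"
    unfolding has_sum_def by (simp flip: sum_ennreal add: ennreal_max_0)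
  then show "(\<Sum>\<^sub>\<infinity>i\<in>A. ennreal (f i)) = ennreal (\<Sum>\<^sub>\<infinity>i\<in>A. max 0 (f i))"
    by (rule infsumI)
qed

lemma generation_sum_eq:
  assumes "(\<lambda>i. Q i \<omega> * path_weight C i \<omega>) summable_on generation N n \<omega>"
  shows "generation_sum Q N C n \<omega> =
           ereal (\<Sum>\<^sub>\<infinity>i\<in>generation N n \<omega>. Q i \<omega> * path_weight C i \<omega>)"
proof -
  define f where "f = (\<lambda>i. Q i \<omega> * path_weight C i \<omega>)"
  define A where "A = generation N n \<omega>"
  have f: "f summable_on A" "(\<lambda>i. - f i) summable_on A"
    using assms unfolding f_def A_def by (simp_all only: summable_on_uminus)
  note p = infsum_ennreal_max[OF f(1)] and m = infsum_ennreal_max[OF f(2)]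
  have "f i = max 0 (f i) + - max 0 (- f i)" for i
    by auto
  then have "infsum f A = (\<Sum>\<^sub>\<infinity>i\<in>A. max 0 (f i) + - max 0 (- f i))"
    by (intro infsum_cong)
  also have "\<dots> = (\<Sum>\<^sub>\<infinity>i\<in>A. max 0 (f i)) + (\<Sum>\<^sub>\<infinity>i\<in>A. - max 0 (- f i))"
    using p(1) m(1) by (intro infsum_add) (simp_all only: summable_on_uminus)
  finally have "infsum f A = (\<Sum>\<^sub>\<infinity>i\<in>A. max 0 (f i)) - (\<Sum>\<^sub>\<infinity>i\<in>A. max 0 (- f i))"
    by (simp add: infsum_uminus)
  moreover have "generation_sum Q N C n \<omega> =
      enn2ereal (\<Sum>\<^sub>\<infinity>i\<in>A. ennreal (f i)) - enn2ereal (\<Sum>\<^sub>\<infinity>i\<in>A. ennreal (- f i))"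
    by (simp add: generation_sum_def f_def A_def)
  moreover have "(\<Sum>\<^sub>\<infinity>i\<in>A. max 0 (f i)) \<ge> 0" "(\<Sum>\<^sub>\<infinity>i\<in>A. max 0 (- f i)) \<ge> 0"
    by (auto intro: infsum_nonneg)
  ultimately have "generation_sum Q N C n \<omega> = ereal (infsum f A)"
    by (simp add: p(2) m(2) enn2ereal_ennreal)
  then show ?thesis
    by (simp add: f_def A_def)
qed

text \<open>
  Functionals of the law of the generic vector \<open>(Q, N, C\<^sub>1, \<dots>, C\<^sub>N)\<close>, which is the vector
  at the root.
\<close>

definition total_weight ::
  "(nat list \<Rightarrow> 'a \<Rightarrow> enat) \<Rightarrow> (nat list \<Rightarrow> 'a \<Rightarrow> real) \<Rightarrow> 'a \<Rightarrow> ennreal" where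
  "total_weight N C \<omega> = (\<Sum>\<^sub>\<infinity>j\<in>offspring (N [] \<omega>). ennreal (C [j] \<omega>))"

definition weight_moment ::
  "'a measure \<Rightarrow> (nat list \<Rightarrow> 'a \<Rightarrow> enat) \<Rightarrow> (nat list \<Rightarrow> 'a \<Rightarrow> real) \<Rightarrow> real \<Rightarrow> ennreal" where
  "weight_moment M N C \<beta> =
     (\<integral>\<^sup>+\<omega>. (\<Sum>\<^sub>\<infinity>j\<in>offspring (N [] \<omega>). ennreal (C [j] \<omega> powr \<beta>)) \<partial>M)"

end

theory Submission
  imports Defs
begin

text \<open>
  Write \<open>G x\<close> for the tail of \<open>Q\<close>. Conditionally on the marks in the generations before the \<open>n\<close>-th one,
  \<open>W\<^sub>n = (\<Sum>i. w\<^sub>i Q\<^sub>i)\<close> is a sum of independent copies of \<open>Q\<close> with constant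
  weights \<open>w\<^sub>i\<close>. So the proof is a moment estimate for sums of independent variables. Negative values
  of \<open>Q\<close> only decrease the sum, so let \<open>Q \<ge> 0\<close>.

  The sum can exceed \<open>x\<close> only if the sum of the terms \<open>min (w\<^sub>i Q\<^sub>i) x\<close> is at least \<open>x\<close>.
  Take \<open>p\<close> slightly larger than \<open>\<alpha>\<close>. By Markov's inequality and Rosenthal's inequality (lemma
  \<open>rosenthal\<close>), the probability of this is, up to a constant, at most \<open>x powr (-p)\<close> times the expectation
  of \<open>(\<Sum>i. E (min (w\<^sub>i Q) x powr p)) + (\<Sum>i. w\<^sub>i E Q) powr p\<close>, where \<open>E\<close> averages over \<open>Q\<close>
  with the weights fixed.

  \<^item> By Potter's bounds, a term of the first sum is at most a constant times
    \<open>x powr p * G x * (w\<^sub>i powr a + w\<^sub>i powr b)\<close>, where \<open>a\<close> and \<open>b\<close> are slightly smaller and larger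
    than \<open>\<alpha>\<close> (lemma \<open>truncated_moment_le\<close>). The expectation of \<open>\<Sum>i. w\<^sub>i powr \<beta>\<close> over the
    \<open>n\<close>-th generation is \<open>\<rho>\<^sub>\<beta> ^ n\<close> (lemma \<open>weight_power_sum_le\<close>), and \<open>\<rho>\<^sub>\<beta> < \<eta>\<close> for all
    \<open>\<beta>\<close> from 1 to a bit above \<open>\<alpha>\<close>, because \<open>\<rho>\<^sub>\<beta>\<close> is convex in \<open>\<beta>\<close> and finite at
    \<open>\<alpha> + \<epsilon>\<close>. So this part is of order \<open>\<eta> ^ n * G x\<close>.

  \<^item> The second part is of order \<open>x powr (-p) * \<eta> ^ n\<close>, since the \<open>p\<close>-th moment of the total weight of
    the \<open>n\<close>-th generation is of order \<open>\<eta> ^ n\<close> (lemma \<open>weight_sum_moment_le\<close>). That is another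
    application of Rosenthal's inequality, to the passage from one generation to the next; here it is
    important that the power of the mean enters with a factor close to 1. Finally \<open>x powr (-p)\<close> is at
    most a constant times \<open>G x\<close>, because \<open>p > \<alpha>\<close>.

  The generations may be infinite. The estimates are made for the nodes with labels at most \<open>m\<close>, with
  constants independent of \<open>m\<close>, and monotone convergence in \<open>m\<close> gives the theorem.
\<close>

section \<open>Power inequalities\<close>

definition powr_add_const :: "real \<Rightarrow> real \<Rightarrow> real" where
  "powr_add_const s \<delta> = (1 + 1 / ((1 + \<delta>) powr (1 / s) - 1)) powr s"

lemma powr_add_const_pos:
  assumes "s > 0" "\<delta> > 0"
  shows "powr_add_const s \<delta> > 0"
proof -
  have "(1 + \<delta>) powr (1 / s) - 1 > 0"
    using assms by simp
  then show ?thesis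
    by (simp add: powr_add_const_def add_pos_pos less_imp_neq[THEN not_sym])
qed

text \<open>
  For \<open>s \<le> 1\<close> the function \<open>z powr s\<close> is subadditive, but for larger \<open>s\<close> it is not. What survives
  for every \<open>s\<close> is that the factor of one summand can be made as close to 1 as desired, if the other
  summand pays for it: either \<open>a \<le> t * b\<close>, and then \<open>a + b\<close> is \<open>b\<close> up to the factor \<open>1 + t\<close>, or \<open>b\<close> is
  dominated by a multiple of \<open>a\<close>. The threshold \<open>t\<close> solves \<open>(1 + t) powr s = 1 + \<delta>\<close>.
\<close>

lemma powr_add_le_near_one:
  fixes a b s \<delta> :: real
  assumes "s > 0" "\<delta> > 0" and ab: "a \<ge> 0" "b \<ge> 0"
  shows "(a + b) powr s \<le> powr_add_const s \<delta> * a powr s + (1 + \<delta>) * b powr s"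
proof -
  define t where "t = (1 + \<delta>) powr (1 / s) - 1"
  have t: "t > 0"
    using assms by (simp add: t_def)
  have t_pow: "(1 + t) powr s = 1 + \<delta>"
    using assms by (simp add: t_def powr_powr)
  have K: "powr_add_const s \<delta> = (1 + 1 / t) powr s"
    by (simp add: powr_add_const_def t_def)
  show ?thesis
  proof (cases "a \<le> t * b")
    case True
    then have "(a + b) powr s \<le> ((1 + t) * b) powr s"
      using ab assms by (intro powr_mono2) (auto simp: algebra_simps)
    also have "\<dots> = (1 + \<delta>) * b powr s"
      using ab t by (simp add: powr_mult t_pow)
    also have "\<dots> \<le> powr_add_const s \<delta> * a powr s + (1 + \<delta>) * b powr s"
      by (simp add: K)
    finally show ?thesis .
  next
    case False
    then have "(a + b) powr s \<le> ((1 + 1 / t) * a) powr s"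
      using ab assms t by (intro powr_mono2) (auto simp: field_simps)
    also have "\<dots> = powr_add_const s \<delta> * a powr s"
      using ab t by (simp add: powr_mult K)
    also have "\<dots> \<le> powr_add_const s \<delta> * a powr s + (1 + \<delta>) * b powr s"
      using assms by simp
    finally show ?thesis .
  qed
qed

lemma mult_powr_le_Young:
  fixes a b p :: real
  assumes "p > 1" "a \<ge> 0" "b \<ge> 0"
  shows "a * b powr (p - 1) \<le> a powr p / p + (p - 1) / p * b powr p"
proof -
  have "1 / p + 1 / (p / (p - 1)) = 1"
    using assms by (simp add: field_simps)
  then have "a * b powr (p - 1) \<le> a powr p / p + (b powr (p - 1)) powr (p / (p - 1)) / (p / (p - 1))"
    using assms by (intro Youngs_inequality) (auto simp: field_simps)
  moreover have "(p - 1) * (p / (p - 1)) = p"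
    using assms by simp
  ultimately show ?thesis
    using assms by (simp add: powr_powr mult.commute)
qed

lemma powr_interpolation:
  fixes c s t \<theta> :: real
  assumes "c \<ge> 0" "0 \<le> \<theta>" "\<theta> \<le> 1"
  shows "c powr ((1 - \<theta>) * s + \<theta> * t) \<le> (1 - \<theta>) * c powr s + \<theta> * c powr t"
proof (cases "c = 0")
  case False
  then have "(c powr s) powr (1 - \<theta>) * (c powr t) powr \<theta> \<le> (1 - \<theta>) * c powr s + \<theta> * c powr t"
    using assms by (intro Youngs_inequality_0) auto
  then show ?thesis
    by (simp add: powr_powr powr_add mult.commute)
qed simp

lemma powr_le_one_plus:
  fixes x s t :: real
  assumes "x \<ge> 0" "0 \<le> s" "s \<le> t"
  shows "x powr s \<le> 1 + x powr t"
proof (cases "x \<le> 1")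
  case True
  then have "x powr s \<le> 1"
    using assms by (intro powr_le1) auto
  then show ?thesis
    by (simp add: add_increasing2)
next
  case False
  then have "x powr s \<le> x powr t"
    using assms by (intro powr_mono) auto
  then show ?thesis
    by simp
qed

text \<open>
  A crude bound, whose only purpose is to show that a finite sum inherits its \<open>p\<close>-th moment from the
  summands.
\<close>

lemma powr_sum_le:
  fixes y :: "'i \<Rightarrow> real"
  assumes "finite I" "\<And>i. i \<in> I \<Longrightarrow> y i \<ge> 0" "s \<ge> 0"
  shows "(\<Sum>i\<in>I. y i) powr s \<le> real (card I) powr s * (\<Sum>i\<in>I. y i powr s)"
proof (cases "I = {}")
  case False
  define m where "m = Max (y ` I)"
  have m: "y i \<le> m" if "i \<in> I" for i
    using assms that by (simp add: m_def)
  have "m \<in> y ` I"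
    using False assms by (auto simp: m_def)
  then obtain k where k: "k \<in> I" "m = y k"
    by auto
  have "(\<Sum>i\<in>I. y i) \<le> real (card I) * m"
    using m by (intro sum_bounded_above) auto
  then have "(\<Sum>i\<in>I. y i) powr s \<le> (real (card I) * m) powr s"
    using assms by (intro powr_mono2) (auto intro: sum_nonneg)
  also have "\<dots> = real (card I) powr s * y k powr s"
    using k assms by (simp add: powr_mult)
  also have "\<dots> \<le> real (card I) powr s * (\<Sum>i\<in>I. y i powr s)"
    using k assms by (intro mult_left_mono member_le_sum) auto
  finally show ?thesis .
qed simp

lemma sum_powr_le:
  fixes y :: "'i \<Rightarrow> real"
  assumes "finite I" "\<And>i. i \<in> I \<Longrightarrow> y i \<ge> 0" "s \<ge> 1"
  shows "(\<Sum>i\<in>I. y i powr s) \<le> (\<Sum>i\<in>I. y i) powr s"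
proof -
  have mult_pow: "z * z powr (s - 1) = z powr s" if "z \<ge> 0" for z :: real
    using that by (cases "z = 0") (auto simp: powr_mult_base)
  have "(\<Sum>i\<in>I. y i powr s) = (\<Sum>i\<in>I. y i * y i powr (s - 1))"
    using assms by (intro sum.cong) (auto simp: mult_pow)
  also have "\<dots> \<le> (\<Sum>i\<in>I. y i * (\<Sum>j\<in>I. y j) powr (s - 1))"
    using assms by (intro sum_mono mult_left_mono powr_mono2 member_le_sum) auto
  also have "\<dots> = (\<Sum>i\<in>I. y i) powr s"
    using assms by (simp add: mult_pow sum_nonneg flip: sum_distrib_right)
  finally show ?thesis .
qed

section \<open>Rosenthal's inequality for nonnegative summands\<close>

text \<open>
  In the proof of Rosenthal's inequality below, a slack \<open>d\<close> in \<open>powr_add_le_near_one\<close> gets amplified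
  to the slack \<open>(1 + d) / (1 - d * (p - 1)) - 1\<close> of the final bound. The following value of \<open>d\<close>
  makes the latter equal to \<open>\<delta>\<close>.
\<close>

definition rosenthal_slack :: "real \<Rightarrow> real \<Rightarrow> real" where
  "rosenthal_slack p \<delta> = \<delta> / (1 + (1 + \<delta>) * (p - 1))"

definition rosenthal_const :: "real \<Rightarrow> real \<Rightarrow> real" where
  "rosenthal_const p \<delta> = powr_add_const (p - 1) (rosenthal_slack p \<delta>) /
     (1 - (1 + rosenthal_slack p \<delta>) * (p - 1) / p)"

lemma rosenthal_slack:
  fixes p \<delta> :: real
  assumes p: "p > 1" and \<delta>: "\<delta> > 0"
  defines "d \<equiv> rosenthal_slack p \<delta>"
  defines "e \<equiv> 1 - (1 + d) * (p - 1) / p"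
  shows "d > 0" "e > 0" "(1 + d) / (p * e) = 1 + \<delta>"
proof -
  have den: "1 + (1 + \<delta>) * (p - 1) > 0"
    using p \<delta> by (intro add_pos_pos) auto
  show d: "d > 0"
    using \<delta> den by (simp add: d_def rosenthal_slack_def)
  have d_eq: "d * (1 + (1 + \<delta>) * (p - 1)) = \<delta>"
    using den by (simp add: d_def rosenthal_slack_def)
  have pe: "p * e = 1 - d * (p - 1)"
  proof -
    have "p * ((1 + d) * (p - 1) / p) = (1 + d) * (p - 1)"
      using p by simp
    then have "p * e = p - (1 + d) * (p - 1)"
      unfolding e_def right_diff_distrib by (simp only: mult_1_right)
    also have "\<dots> = 1 - d * (p - 1)"
      by (simp add: algebra_simps)
    finally show ?thesis .
  qed
  have "d * (p - 1) * (1 + \<delta>) < 1 * (1 + \<delta>)"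
  proof -
    have "d * (p - 1) * (1 + \<delta>) = \<delta> - d"
      using d_eq by (simp add: algebra_simps)
    also have "\<dots> < 1 * (1 + \<delta>)"
      using d by simp
    finally show ?thesis .
  qed
  then have pe_pos: "p * e > 0"
    using \<delta> unfolding pe by (subst (asm) mult_less_cancel_right) auto
  then show "e > 0"
    using p by (simp add: zero_less_mult_iff)
  have "(1 + \<delta>) * (p * e) = 1 + d"
    unfolding pe using d_eq by (simp add: algebra_simps)
  then show "(1 + d) / (p * e) = 1 + \<delta>"
    using pe_pos by (simp only: nonzero_divide_eq_eq less_imp_neq[THEN not_sym] not_False_eq_True)
qed

lemma rosenthal_const_pos:
  assumes "p > 1" "\<delta> > 0"
  shows "rosenthal_const p \<delta> > 0"
  unfolding rosenthal_const_def using rosenthal_slack[OF assms] assms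
  by (intro divide_pos_pos powr_add_const_pos) auto

text \<open>
  Rosenthal's inequality for independent nonnegative summands, in a form in which the factor of the
  power of the mean is arbitrarily close to 1. This sharpness is what makes the recursion in
  \<open>weight_sum_moment_le\<close> contract.

  Let \<open>S\<close> be the sum, \<open>R k\<close> the sum without the \<open>k\<close>-th term, and \<open>m\<close> the mean of \<open>S\<close>. Since
  \<open>S powr p = (\<Sum>k. y k * (y k + R k) powr (p - 1))\<close>, splitting the power gives terms
  \<open>y k powr p\<close>, and terms \<open>y k * R k powr (p - 1)\<close> with almost no loss. By independence the latter
  have expectations that add up to at most \<open>m * E (S powr (p - 1))\<close>. Young's inequality bounds this by
  \<open>m powr p / p + (p - 1) / p * E (S powr p)\<close>, and since \<open>(p - 1) / p < 1\<close>, the last term can be absorbed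
  into the left-hand side.
\<close>

lemma (in prob_space)
  fixes p \<delta> :: real and y :: "'i \<Rightarrow> 'a \<Rightarrow> real"
  assumes p: "p > 1" and \<delta>: "\<delta> > 0"
    and I: "finite I" and ind: "indep_vars (\<lambda>_. borel) y I"
    and pos: "\<And>i \<omega>. i \<in> I \<Longrightarrow> 0 \<le> y i \<omega>"
    and int: "\<And>i. i \<in> I \<Longrightarrow> integrable M (\<lambda>\<omega>. y i \<omega> powr p)"
  shows integrable_sum_powr: "integrable M (\<lambda>\<omega>. (\<Sum>i\<in>I. y i \<omega>) powr p)"
    and rosenthal_integral: "(\<integral>\<omega>. (\<Sum>i\<in>I. y i \<omega>) powr p \<partial>M) \<le>
      rosenthal_const p \<delta> * (\<Sum>i\<in>I. \<integral>\<omega>. y i \<omega> powr p \<partial>M) +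
      (1 + \<delta>) * (\<Sum>i\<in>I. \<integral>\<omega>. y i \<omega> \<partial>M) powr p"
proof -
  define d where "d = rosenthal_slack p \<delta>"
  define e where "e = 1 - (1 + d) * (p - 1) / p"
  define K where "K = powr_add_const (p - 1) d"
  have d: "d > 0" and e: "e > 0" and coeff: "(1 + d) / (p * e) = 1 + \<delta>"
    using rosenthal_slack[OF p \<delta>] by (auto simp: d_def e_def)
  have K_e: "rosenthal_const p \<delta> = K / e"
    by (simp add: rosenthal_const_def K_def e_def d_def)
  have mult_pow: "z * z powr (p - 1) = z powr p" if "z \<ge> 0" for z :: real
    using that p by (cases "z = 0") (auto simp: powr_mult_base)
  have meas [measurable]: "y i \<in> borel_measurable M" if "i \<in> I" for i
    using ind that by (auto simp: indep_vars_def)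
  define S where "S \<omega> = (\<Sum>i\<in>I. y i \<omega>)" for \<omega>
  define R where "R k \<omega> = (\<Sum>i\<in>I - {k}. y i \<omega>)" for k \<omega>
  have S [measurable]: "S \<in> borel_measurable M"
    unfolding S_def by measurable
  have R [measurable]: "R k \<in> borel_measurable M" for k
    unfolding R_def by measurable
  have S_pos: "S \<omega> \<ge> 0" and R_pos: "R k \<omega> \<ge> 0" for k \<omega>
    by (auto simp: S_def R_def intro!: sum_nonneg pos)
  have S_eq: "S \<omega> = y k \<omega> + R k \<omega>" if "k \<in> I" for k \<omega>
    unfolding S_def R_def using I that by (rule sum.remove)
  have S_int: "integrable M (\<lambda>\<omega>. S \<omega> powr p)"
  proof (rule Bochner_Integration.integrable_bound)
    show "integrable M (\<lambda>\<omega>. real (card I) powr p * (\<Sum>i\<in>I. y i \<omega> powr p))"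
      using int by auto
    show "AE \<omega> in M. norm (S \<omega> powr p) \<le> norm (real (card I) powr p * (\<Sum>i\<in>I. y i \<omega> powr p))"
      using powr_sum_le[OF I pos, of _ p] p by (auto simp: S_def sum_nonneg abs_mult)
  qed measurable
  have y_int: "integrable M (y k)" if "k \<in> I" for k
  proof (rule Bochner_Integration.integrable_bound)
    show "integrable M (\<lambda>\<omega>. 1 + y k \<omega> powr p)"
      using int that by auto
    show "AE \<omega> in M. norm (y k \<omega>) \<le> norm (1 + y k \<omega> powr p)"
      using powr_le_one_plus[of "y k _" 1 p] pos[OF that] p by (auto simp: add_nonneg_nonneg)
  qed (use that in measurable)
  have S1_int: "integrable M (\<lambda>\<omega>. S \<omega> powr (p - 1))"
  proof (rule Bochner_Integration.integrable_bound)
    show "integrable M (\<lambda>\<omega>. 1 + S \<omega> powr p)"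
      using S_int by auto
    show "AE \<omega> in M. norm (S \<omega> powr (p - 1)) \<le> norm (1 + S \<omega> powr p)"
      using powr_le_one_plus[of "S _" "p - 1" p] S_pos p by (auto simp: add_nonneg_nonneg)
  qed measurable
  have R_le: "R k \<omega> powr (p - 1) \<le> S \<omega> powr (p - 1)" if "k \<in> I" for k \<omega>
    using R_pos S_eq[OF that] pos[OF that] p by (intro powr_mono2) auto
  have R1_int: "integrable M (\<lambda>\<omega>. R k \<omega> powr (p - 1))" if "k \<in> I" for k
    by (rule Bochner_Integration.integrable_bound[OF S1_int]) (use R_le that in auto)
  have indep: "indep_var borel (y k) borel (\<lambda>\<omega>. R k \<omega> powr (p - 1))" if "k \<in> I" for k
  proof -
    have "indep_var borel (y k) borel (R k)"
      unfolding R_def using I that ind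
      by (intro indep_vars_sum) (auto simp: insert_absorb)
    then have "indep_var borel ((\<lambda>x. x) \<circ> y k) borel ((\<lambda>x. x powr (p - 1)) \<circ> R k)"
      by (rule indep_var_compose) auto
    then show ?thesis
      by (simp add: comp_def)
  qed
  note prod_int = indep_var_integrable[OF indep y_int R1_int]
  note prod_eq = indep_var_lebesgue_integral[OF indep y_int R1_int]
  define m where "m = (\<Sum>i\<in>I. \<integral>\<omega>. y i \<omega> \<partial>M)"
  define A where "A = (\<Sum>i\<in>I. \<integral>\<omega>. y i \<omega> powr p \<partial>M)"
  define E where "E = (\<integral>\<omega>. S \<omega> powr p \<partial>M)"
  have m_pos: "m \<ge> 0"
    unfolding m_def by (intro sum_nonneg integral_nonneg) (auto simp: pos)
  have "S \<omega> powr p \<le> (\<Sum>k\<in>I. K * y k \<omega> powr p + (1 + d) * (y k \<omega> * R k \<omega> powr (p - 1)))" for \<omega>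
  proof -
    have "S \<omega> powr p = (\<Sum>k\<in>I. y k \<omega> * (y k \<omega> + R k \<omega>) powr (p - 1))"
      using S_pos by (simp add: mult_pow[symmetric] sum_distrib_right S_eq[symmetric])
        (simp add: S_def sum_distrib_right)
    also have "\<dots> \<le> (\<Sum>k\<in>I. y k \<omega> * (K * y k \<omega> powr (p - 1) + (1 + d) * R k \<omega> powr (p - 1)))"
      using pos R_pos p d unfolding K_def by (intro sum_mono mult_left_mono powr_add_le_near_one) auto
    also have "\<dots> = (\<Sum>k\<in>I. K * y k \<omega> powr p + (1 + d) * (y k \<omega> * R k \<omega> powr (p - 1)))"
      by (intro sum.cong) (auto simp: mult_pow[OF pos, symmetric] algebra_simps)
    finally show ?thesis .
  qed
  then have "E \<le> (\<integral>\<omega>. (\<Sum>k\<in>I. K * y k \<omega> powr p + (1 + d) * (y k \<omega> * R k \<omega> powr (p - 1))) \<partial>M)"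
    unfolding E_def using S_int int prod_int by (intro integral_mono) auto
  also have "\<dots> = (\<Sum>k\<in>I. K * (\<integral>\<omega>. y k \<omega> powr p \<partial>M)
              + (1 + d) * ((\<integral>\<omega>. y k \<omega> \<partial>M) * (\<integral>\<omega>. R k \<omega> powr (p - 1) \<partial>M)))"
    using int prod_int by (simp add: prod_eq)
  also have "\<dots> \<le> (\<Sum>k\<in>I. K * (\<integral>\<omega>. y k \<omega> powr p \<partial>M)
              + (1 + d) * ((\<integral>\<omega>. y k \<omega> \<partial>M) * (\<integral>\<omega>. S \<omega> powr (p - 1) \<partial>M)))"
    using d R1_int S1_int R_le pos
    by (intro sum_mono add_left_mono mult_left_mono integral_mono integral_nonneg) auto
  also have "\<dots> = K * A + (1 + d) * (m * (\<integral>\<omega>. S \<omega> powr (p - 1) \<partial>M))"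
    by (simp add: A_def m_def sum.distrib sum_distrib_left sum_distrib_right)
  also have "m * (\<integral>\<omega>. S \<omega> powr (p - 1) \<partial>M) = (\<integral>\<omega>. m * S \<omega> powr (p - 1) \<partial>M)"
    by simp
  also have "\<dots> \<le> (\<integral>\<omega>. m powr p / p + (p - 1) / p * S \<omega> powr p \<partial>M)"
    using S1_int S_int mult_powr_le_Young[OF p m_pos S_pos] by (intro integral_mono) auto
  also have "\<dots> = m powr p / p + (p - 1) / p * E"
    using S_int by (simp add: E_def prob_space)
  finally have "E \<le> K * A + (1 + d) * (m powr p / p + (p - 1) / p * E)"
    using d by simp
  then have "e * E \<le> K * A + (1 + d) / p * m powr p"
    using p by (simp add: e_def algebra_simps)
  then have "E \<le> (K * A + (1 + d) / p * m powr p) / e"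
    using e by (simp add: pos_le_divide_eq mult.commute)
  also have "\<dots> = K / e * A + (1 + d) / (p * e) * m powr p"
    by (subst add_divide_distrib) (simp only: times_divide_eq_left divide_divide_eq_left)
  finally have "E \<le> K / e * A + (1 + \<delta>) * m powr p"
    by (simp only: coeff)
  then show "(\<integral>\<omega>. (\<Sum>i\<in>I. y i \<omega>) powr p \<partial>M) \<le>
      rosenthal_const p \<delta> * (\<Sum>i\<in>I. \<integral>\<omega>. y i \<omega> powr p \<partial>M) +
      (1 + \<delta>) * (\<Sum>i\<in>I. \<integral>\<omega>. y i \<omega> \<partial>M) powr p"
    by (simp add: E_def S_def A_def m_def K_e)
  show "integrable M (\<lambda>\<omega>. (\<Sum>i\<in>I. y i \<omega>) powr p)"
    using S_int by (simp add: S_def)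
qed

text \<open>
  The same in terms of extended nonnegative integrals, where bounds on the moments include their
  finiteness.
\<close>

lemma (in prob_space) rosenthal:
  fixes p \<delta> :: real and y :: "'i \<Rightarrow> 'a \<Rightarrow> real"
  assumes p: "p > 1" and \<delta>: "\<delta> > 0"
    and I: "finite I" and ind: "indep_vars (\<lambda>_. borel) y I"
    and pos: "\<And>i \<omega>. i \<in> I \<Longrightarrow> 0 \<le> y i \<omega>"
    and A0: "\<And>i. i \<in> I \<Longrightarrow> 0 \<le> A i" and b0: "\<And>i. i \<in> I \<Longrightarrow> 0 \<le> b i"
    and A: "\<And>i. i \<in> I \<Longrightarrow> (\<integral>\<^sup>+\<omega>. ennreal (y i \<omega> powr p) \<partial>M) \<le> ennreal (A i)"
    and b: "\<And>i. i \<in> I \<Longrightarrow> (\<integral>\<^sup>+\<omega>. ennreal (y i \<omega>) \<partial>M) \<le> ennreal (b i)"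
  shows "(\<integral>\<^sup>+\<omega>. ennreal ((\<Sum>i\<in>I. y i \<omega>) powr p) \<partial>M) \<le>
    ennreal (rosenthal_const p \<delta> * (\<Sum>i\<in>I. A i) + (1 + \<delta>) * (\<Sum>i\<in>I. b i) powr p)"
proof -
  have meas [measurable]: "y i \<in> borel_measurable M" if "i \<in> I" for i
    using ind that by (auto simp: indep_vars_def)
  have int: "integrable M (\<lambda>\<omega>. y i \<omega> powr p)" "integrable M (y i)" if "i \<in> I" for i
    using that pos A[OF that] b[OF that]
    by (auto intro!: integrableI_nonneg simp: le_less_trans[OF _ ennreal_less_top])
  have le: "(\<integral>\<omega>. y i \<omega> powr p \<partial>M) \<le> A i" "(\<integral>\<omega>. y i \<omega> \<partial>M) \<le> b i" if "i \<in> I" for i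
    using that pos A[OF that] b[OF that] int[OF that] A0 b0
    by (auto simp: nn_integral_eq_integral)
  have "(\<integral>\<^sup>+\<omega>. ennreal ((\<Sum>i\<in>I. y i \<omega>) powr p) \<partial>M) =
      ennreal (\<integral>\<omega>. (\<Sum>i\<in>I. y i \<omega>) powr p \<partial>M)"
    using integrable_sum_powr[OF p \<delta> I ind pos int(1)] by (intro nn_integral_eq_integral) auto
  also have "\<dots> \<le> ennreal (rosenthal_const p \<delta> * (\<Sum>i\<in>I. \<integral>\<omega>. y i \<omega> powr p \<partial>M)
                      + (1 + \<delta>) * (\<Sum>i\<in>I. \<integral>\<omega>. y i \<omega> \<partial>M) powr p)"
    using rosenthal_integral[OF p \<delta> I ind pos int(1)] by (intro ennreal_leI) auto
  also have "\<dots> \<le> ennreal (rosenthal_const p \<delta> * (\<Sum>i\<in>I. A i) + (1 + \<delta>) * (\<Sum>i\<in>I. b i) powr p)"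
    using rosenthal_const_pos[OF p \<delta>] \<delta> p le pos
    by (intro ennreal_leI add_mono mult_left_mono sum_mono powr_mono2 sum_nonneg integral_nonneg) auto
  finally show ?thesis .
qed

section \<open>Regularly varying tails\<close>

lemma regularly_varying_pos:
  assumes "regularly_varying a f" "x > 0"
  shows "f x > 0"
  using assms by (auto simp: regularly_varying_def slowly_varying_def)

lemma regularly_varying_ratio:
  assumes "regularly_varying a f" "c > 0"
  shows "((\<lambda>x. f (c * x) / f x) \<longlongrightarrow> c powr a) at_top"
proof -
  obtain L where L: "slowly_varying L" "\<And>x. x > 0 \<Longrightarrow> f x = x powr a * L x"
    using assms by (auto simp: regularly_varying_def)
  have "((\<lambda>x. c powr a * (L (c * x) / L x)) \<longlongrightarrow> c powr a * 1) at_top"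
    using L(1) assms(2) by (intro tendsto_intros) (auto simp: slowly_varying_def)
  moreover have "\<forall>\<^sub>F x in at_top. c powr a * (L (c * x) / L x) = f (c * x) / f x"
    using eventually_gt_at_top[of 0]
    by eventually_elim (use assms(2) L(2) in \<open>simp add: powr_mult\<close>)
  ultimately show ?thesis
    by (simp add: filterlim_cong)
qed

lemma power_of_two_bracket:
  fixes t :: real
  assumes "t \<ge> 1"
  obtains k :: nat where "2 ^ k \<le> t" "t < 2 ^ Suc k"
proof -
  define k where "k = nat \<lfloor>log 2 t\<rfloor>"
  have "log 2 t \<ge> 0"
    using assms by simp
  then have "real k = of_int \<lfloor>log 2 t\<rfloor>"
    by (simp add: k_def)
  then have "real k \<le> log 2 t" "log 2 t < real (Suc k)"
    by linarith+
  then have "2 powr real k \<le> t" "t < 2 powr real (Suc k)"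
    using assms by (auto simp: le_log_iff log_less_iff)
  then show thesis
    by (intro that[of k]) (auto simp only: powr_realpow[OF zero_less_numeral])
qed

text \<open>
  Iterating the bounds for one doubling controls \<open>G (2 ^ k * x)\<close>, and monotonicity of \<open>G\<close>
  fills the gaps between powers of two at the cost of a factor \<open>2 powr a\<close> or \<open>2 powr (-b)\<close>. On the
  bounded range between 1 and \<open>x0\<close> the function \<open>G\<close> varies by at most a constant factor, so that the
  bounds extend down to 1.
\<close>

lemma potter_bounds_from_doubling:
  fixes G :: "real \<Rightarrow> real"
  assumes anti: "\<And>x y. 0 < x \<Longrightarrow> x \<le> y \<Longrightarrow> G y \<le> G x"
    and pos: "\<And>x. x > 0 \<Longrightarrow> G x > 0"
    and x0: "x0 \<ge> 1" and a: "a \<ge> 0" and b: "b \<ge> 0"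
    and upper: "\<And>x. x \<ge> x0 \<Longrightarrow> G (2 * x) \<le> 2 powr (-a) * G x"
    and lower: "\<And>x. x \<ge> x0 \<Longrightarrow> 2 powr (-b) * G x \<le> G (2 * x)"
  shows "\<exists>K k. K > 0 \<and> k > 0 \<and> (\<forall>x\<ge>1. \<forall>t\<ge>1.
    G (t * x) \<le> K * t powr (-a) * G x \<and> k * t powr (-b) * G x \<le> G (t * x))"
proof -
  have pow_upper: "G (2 ^ k * x) \<le> (2 ^ k) powr (-a) * G x" if "x \<ge> x0" for x k
  proof (induction k)
    case (Suc k)
    have "1 * x \<le> 2 ^ k * x"
      using that x0 by (intro mult_right_mono) auto
    then have "G (2 ^ Suc k * x) \<le> 2 powr (-a) * G (2 ^ k * x)"
      using upper[of "2 ^ k * x"] that by (simp add: mult.assoc)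
    also have "\<dots> \<le> 2 powr (-a) * ((2 ^ k) powr (-a) * G x)"
      using Suc by (intro mult_left_mono) auto
    finally show ?case
      by (simp add: powr_mult)
  qed simp
  have pow_lower: "(2 ^ k) powr (-b) * G x \<le> G (2 ^ k * x)" if "x \<ge> x0" for x k
  proof (induction k)
    case (Suc k)
    have "1 * x \<le> 2 ^ k * x"
      using that x0 by (intro mult_right_mono) auto
    then have step: "2 powr (-b) * G (2 ^ k * x) \<le> G (2 ^ Suc k * x)"
      using lower[of "2 ^ k * x"] that by (simp add: mult.assoc)
    have "(2 ^ Suc k) powr (-b) * G x = 2 powr (-b) * ((2 ^ k) powr (-b) * G x)"
      by (simp add: powr_mult)
    also have "\<dots> \<le> 2 powr (-b) * G (2 ^ k * x)"
      using Suc by (intro mult_left_mono) auto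
    also note step
    finally show ?case .
  qed simp
  have far_upper: "G (t * x) \<le> 2 powr a * t powr (-a) * G x" if "x \<ge> x0" "t \<ge> 1" for x t
  proof -
    obtain k where k: "2 ^ k \<le> t" "t < 2 ^ Suc k"
      using power_of_two_bracket \<open>t \<ge> 1\<close> .
    have "G (t * x) \<le> G (2 ^ k * x)"
      using k that x0 by (intro anti mult_right_mono) auto
    also have "\<dots> \<le> (2 ^ k) powr (-a) * G x"
      using that(1) by (rule pow_upper)
    also have "\<dots> \<le> (t / 2) powr (-a) * G x"
      using k that a x0 pos[of x] by (intro mult_right_mono powr_mono2') auto
    also have "(t / 2) powr (-a) = 2 powr a * t powr (-a)"
      using that by (simp add: powr_divide powr_minus field_simps)
    finally show ?thesis .
  qed
  have far_lower: "2 powr (-b) * t powr (-b) * G x \<le> G (t * x)" if "x \<ge> x0" "t \<ge> 1" for x t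
  proof -
    obtain k where k: "2 ^ k \<le> t" "t < 2 ^ Suc k"
      using power_of_two_bracket \<open>t \<ge> 1\<close> .
    have "2 powr (-b) * t powr (-b) * G x = (2 * t) powr (-b) * G x"
      using that by (simp add: powr_mult)
    also have "\<dots> \<le> (2 ^ Suc k) powr (-b) * G x"
      using k that b x0 pos[of x] by (intro mult_right_mono powr_mono2') auto
    also have "\<dots> \<le> G (2 ^ Suc k * x)"
      using that(1) by (intro pow_lower)
    also have "\<dots> \<le> G (t * x)"
      using k that x0 by (intro anti mult_right_mono mult_pos_pos) auto
    finally show ?thesis .
  qed
  have G_x0: "G x0 > 0" "G 1 > 0"
    using pos x0 by auto
  show ?thesis
  proof (rule exI[of _ "2 powr a * x0 powr a"], rule exI[of _ "2 powr (-b) * (G x0 / G 1)"],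
      intro conjI allI impI)
    show "2 powr a * x0 powr a > 0" "2 powr (-b) * (G x0 / G 1) > 0"
      using G_x0 x0 by auto
  next
    fix x t :: real assume xt: "x \<ge> 1" "t \<ge> 1"
    have one: "1 \<le> x0 powr a" "1 \<le> 2 powr a"
      using x0 a by (auto intro: ge_one_powr_ge_zero)
    show "G (t * x) \<le> 2 powr a * x0 powr a * t powr (-a) * G x"
    proof (cases "x \<ge> x0")
      case True
      have "G (t * x) \<le> 2 powr a * 1 * t powr (-a) * G x"
        using far_upper[OF True xt(2)] by simp
      also have "\<dots> \<le> 2 powr a * x0 powr a * t powr (-a) * G x"
        using one xt pos[of x] by (intro mult_right_mono mult_left_mono) auto
      finally show ?thesis .
    next
      case x: False
      show ?thesis
      proof (cases "t * x \<ge> x0")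
        case True
        have "G (t * x) = G ((t * x / x0) * x0)"
          using x0 by simp
        also have "\<dots> \<le> 2 powr a * (t * x / x0) powr (-a) * G x0"
          using True x0 by (intro far_upper) auto
        also have "\<dots> \<le> 2 powr a * (t / x0) powr (-a) * G x"
          using x xt x0 a G_x0
          by (intro mult_mono mult_left_mono powr_mono2' anti divide_right_mono) auto
        also have "(t / x0) powr (-a) = x0 powr a * t powr (-a)"
          using xt x0 by (simp add: powr_divide powr_minus field_simps)
        finally show ?thesis
          by (simp only: mult.assoc)
      next
        case False
        then have "t * 1 \<le> x0"
          using xt by (intro order.trans[OF mult_left_mono[of 1 x t]]) auto
        then have "1 \<le> x0 powr a * t powr (-a)"
          using xt a by (simp add: powr_minus field_simps powr_mono2)
        then have "1 * 1 \<le> 2 powr a * (x0 powr a * t powr (-a))"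
          using one by (intro mult_mono) auto
        then have "1 * G x \<le> (2 powr a * (x0 powr a * t powr (-a))) * G x"
          using pos[of x] xt by (intro mult_right_mono) auto
        moreover have "G (t * x) \<le> G x"
          using xt by (intro anti) auto
        ultimately show ?thesis
          by (simp add: mult.assoc)
      qed
    qed
    show "2 powr (-b) * (G x0 / G 1) * t powr (-b) * G x \<le> G (t * x)"
    proof (cases "x \<ge> x0")
      case True
      have "2 powr (-b) * (G x0 / G 1) * t powr (-b) * G x \<le> 2 powr (-b) * 1 * t powr (-b) * G x"
        using G_x0 x0 xt pos[of x] anti[of 1 x0] by (intro mult_right_mono mult_left_mono) auto
      also have "\<dots> \<le> G (t * x)"
        using far_lower[OF True xt(2)] by simp
      finally show ?thesis .
    next
      case False
      have "2 powr (-b) * (G x0 / G 1) * t powr (-b) * G x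
          = 2 powr (-b) * t powr (-b) * G x0 * (G x / G 1)"
        by simp
      also have "\<dots> \<le> 2 powr (-b) * t powr (-b) * G x0 * 1"
        using xt anti[of 1 x] G_x0 by (intro mult_left_mono) auto
      also have "\<dots> \<le> G (t * x0)"
        using far_lower[of x0 t] xt by simp
      also have "\<dots> \<le> G (t * x)"
        using False xt by (intro anti mult_left_mono) auto
      finally show ?thesis .
    qed
  qed
qed

text \<open>
  Potter's bounds for a tail probability. If \<open>x / c \<ge> 1\<close>, the first bound is one of the doubling
  bounds, read from the smaller of \<open>x\<close> and \<open>x / c\<close> to the larger. If \<open>x / c\<close> is smaller than 1, then \<open>G (x / c) \<le> 1\<close>, and \<open>(c / x) powr b\<close> exceeds 1, while \<open>G x\<close> is at least a constant times
  \<open>x powr (-b)\<close>.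
\<close>

lemma regularly_varying_potter:
  fixes G :: "real \<Rightarrow> real"
  assumes anti: "\<And>x y. 0 < x \<Longrightarrow> x \<le> y \<Longrightarrow> G y \<le> G x"
    and le1: "\<And>x. G x \<le> 1"
    and rv: "regularly_varying (-\<alpha>) G"
    and ab: "0 \<le> a" "a < \<alpha>" "\<alpha> < b"
  shows "\<exists>K>0. (\<forall>x\<ge>1. \<forall>c>0. G (x / c) \<le> K * G x * (c powr a + c powr b)) \<and>
    (\<forall>x\<ge>1. G x \<le> K * x powr (-a)) \<and> (\<forall>x\<ge>1. x powr (-b) \<le> K * G x)"
proof -
  have pos: "G x > 0" if "x > 0" for x
    using regularly_varying_pos[OF rv that] .
  have lim: "((\<lambda>x. G (2 * x) / G x) \<longlongrightarrow> 2 powr (-\<alpha>)) at_top"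
    using rv by (rule regularly_varying_ratio) simp
  have "\<forall>\<^sub>F x in at_top. x \<ge> 1 \<and> G (2 * x) / G x < 2 powr (-a) \<and> 2 powr (-b) < G (2 * x) / G x"
    using ab by (intro eventually_conj eventually_ge_at_top order_tendstoD[OF lim]) auto
  then obtain x1 where x1: "\<And>x. x \<ge> x1 \<Longrightarrow>
      x \<ge> 1 \<and> G (2 * x) / G x < 2 powr (-a) \<and> 2 powr (-b) < G (2 * x) / G x"
    unfolding eventually_at_top_linorder by blast
  define x0 where "x0 = max 1 x1"
  have "G (2 * x) \<le> 2 powr (-a) * G x \<and> 2 powr (-b) * G x \<le> G (2 * x)" if "x \<ge> x0" for x
    using x1[of x] pos[of x] that by (auto simp: x0_def field_simps)
  then have "\<exists>K k. K > 0 \<and> k > 0 \<and> (\<forall>x\<ge>1. \<forall>t\<ge>1.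
      G (t * x) \<le> K * t powr (-a) * G x \<and> k * t powr (-b) * G x \<le> G (t * x))"
    using ab by (intro potter_bounds_from_doubling[of G x0] anti pos) (auto simp: x0_def)
  then obtain K k where K: "K > 0" and k: "k > 0"
    and bounds: "\<forall>x\<ge>1. \<forall>t\<ge>1. G (t * x) \<le> K * t powr (-a) * G x \<and> k * t powr (-b) * G x \<le> G (t * x)"
    by blast
  have upper: "G (t * x) \<le> K * t powr (-a) * G x" and lower: "k * t powr (-b) * G x \<le> G (t * x)"
    if "x \<ge> 1" "t \<ge> 1" for x t
    using bounds that by auto
  have G1: "G 1 > 0"
    by (simp add: pos)
  define K' where "K' = Max {K, 1 / k, 1 / (k * G 1)}"
  have K': "K \<le> K'" "1 / k \<le> K'" "1 / (k * G 1) \<le> K'"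
    by (auto simp: K'_def)
  have low: "x powr (-b) \<le> 1 / (k * G 1) * G x" if "x \<ge> 1" for x
    using lower[of 1 x] that k G1 by (simp add: field_simps)
  show ?thesis
  proof (intro exI[of _ K'] conjI allI impI)
    show "K' > 0"
      using K K' by simp
    show "G x \<le> K' * x powr (-a)" if "x \<ge> 1" for x
    proof -
      have "G x \<le> K * x powr (-a) * G 1"
        using upper[of 1 x] that by simp
      also have "\<dots> \<le> K' * x powr (-a) * 1"
        using K K' le1[of 1] G1 by (intro mult_mono) auto
      finally show ?thesis
        by simp
    qed
    show "x powr (-b) \<le> K' * G x" if "x \<ge> 1" for x
    proof -
      note low[OF that]
      also have "1 / (k * G 1) * G x \<le> K' * G x"
        using K'(3) pos[of x] that by (intro mult_right_mono) auto
      finally show ?thesis .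
    qed
    fix x c :: real assume xc: "x \<ge> 1" "c > 0"
    have Gx: "G x > 0"
      using pos xc by simp
    show "G (x / c) \<le> K' * G x * (c powr a + c powr b)"
    proof (cases "c \<le> 1")
      case True
      have "G (x / c) \<le> K * (1 / c) powr (-a) * G x"
        using upper[of x "1 / c"] xc True by simp
      also have "\<dots> = K * G x * c powr a"
        using xc by (simp add: powr_divide powr_minus)
      also have "\<dots> \<le> K' * G x * (c powr a + c powr b)"
        using K' K Gx by (intro mult_mono) auto
      finally show ?thesis .
    next
      case False
      have "\<exists>k'\<in>{1 / k, 1 / (k * G 1)}. G (x / c) \<le> k' * G x * c powr b"
      proof (cases "x / c \<ge> 1")
        case True
        then have "k * c powr (-b) * G (x / c) \<le> G x"
          using lower[of "x / c" c] False by simp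
        then have "G (x / c) \<le> 1 / k * G x * c powr b"
          using k xc by (simp add: powr_minus field_simps)
        then show ?thesis
          by blast
      next
        case far: False
        have "1 \<le> (c / x) powr b"
          using far xc ab by (intro ge_one_powr_ge_zero) (auto simp: field_simps)
        also have "\<dots> = x powr (-b) * c powr b"
          using xc by (simp add: powr_divide powr_minus field_simps)
        also have "\<dots> \<le> 1 / (k * G 1) * G x * c powr b"
          using low[of x] xc by (intro mult_right_mono) auto
        finally show ?thesis
          using le1[of "x / c"] by auto
      qed
      then obtain k' where k': "k' \<le> K'" "G (x / c) \<le> k' * G x * c powr b"
        using K' by auto
      note k'(2)
      also have "k' * G x * c powr b \<le> K' * G x * (c powr a + c powr b)"
        using k' K' K Gx by (intro mult_mono mult_nonneg_nonneg) auto
      finally show ?thesis .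
    qed
  qed
qed

lemma ennreal_le_suminf:
  fixes f :: "nat \<Rightarrow> ennreal"
  shows "f k \<le> (\<Sum>k. f k)"
  using sum_le_suminf[OF summableI, of "{k}" f] by simp

text \<open>
  For an exponent \<open>p\<close> above the index of the tail, the \<open>p\<close>-th moment of a variable truncated at \<open>x\<close> is
  dominated by the values near \<open>x\<close>: cutting the range of the truncated variable into the dyadic
  layers between \<open>x / 2 ^ Suc k\<close> and \<open>x / 2 ^ k\<close> yields a convergent geometric series with ratio
  \<open>2 powr (b - p)\<close>.
\<close>

lemma (in prob_space) truncated_moment_le:
  fixes q :: "'a \<Rightarrow> real"
  assumes [measurable]: "q \<in> borel_measurable M" and q: "\<And>\<omega>. q \<omega> \<ge> 0"
    and K: "K \<ge> 0" and ab: "a \<le> b" "0 < b" "b < p"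
    and tail: "\<And>x c. x \<ge> 1 \<Longrightarrow> c > 0 \<Longrightarrow>
      \<P>(\<omega> in M. q \<omega> > x / c) \<le> K * \<P>(\<omega> in M. q \<omega> > x) * (c powr a + c powr b)"
  shows "\<exists>K'>0. \<forall>x\<ge>1. \<forall>u\<ge>0. (\<integral>\<^sup>+\<omega>. ennreal (min (u * q \<omega>) x powr p) \<partial>M) \<le>
    ennreal (K' * x powr p * \<P>(\<omega> in M. q \<omega> > x) * (u powr a + u powr b))"
proof -
  define r where "r = 2 powr (b - p)"
  have r: "0 < r" "r < 1"
    using ab by (auto simp: r_def powr_less_one)
  define K' where "K' = (K + 1) * 2 powr b / (1 - r)"
  show ?thesis
  proof (intro exI[of _ K'] conjI allI impI)
    show "K' > 0"
      using r K by (auto simp: K'_def)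
    fix x u :: real assume x: "x \<ge> 1" and u: "u \<ge> 0"
    define G where "G = \<P>(\<omega> in M. q \<omega> > x)"
    have G: "G \<ge> 0"
      by (simp add: G_def)
    show "(\<integral>\<^sup>+\<omega>. ennreal (min (u * q \<omega>) x powr p) \<partial>M) \<le>
        ennreal (K' * x powr p * \<P>(\<omega> in M. q \<omega> > x) * (u powr a + u powr b))"
    proof (cases "u = 0")
      case True
      then show ?thesis
        using x by simp
    next
      case False
      then have u: "u > 0"
        using u by simp
      define E where "E k = {\<omega> \<in> space M. q \<omega> > x / (u * 2 ^ Suc k)}" for k
      have [measurable]: "E k \<in> sets M" for k
        by (simp add: E_def)
      have layer: "ennreal (min (u * q \<omega>) x powr p) \<le>
          (\<Sum>k. ennreal ((x / 2 ^ k) powr p) * indicator (E k) \<omega>)" if \<omega>: "\<omega> \<in> space M" for \<omega>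
      proof (cases "q \<omega> = 0")
        case True
        then show ?thesis
          using x by simp
      next
        case False
        define y where "y = min (u * q \<omega>) x"
        have y: "y > 0" "y \<le> x"
          using False q[of \<omega>] u x by (auto simp: y_def)
        obtain k :: nat where k: "2 ^ k \<le> x / y" "x / y < 2 ^ Suc k"
          using power_of_two_bracket[of "x / y"] y by auto
        have "x / 2 ^ Suc k < y"
          using k y by (simp add: field_simps)
        also have "y \<le> u * q \<omega>"
          by (simp add: y_def)
        finally have "x / 2 ^ Suc k < u * q \<omega>" .
        then have "\<omega> \<in> E k"
          using u \<omega> by (simp add: E_def field_simps)
        moreover have "y powr p \<le> (x / 2 ^ k) powr p"
          using k y ab by (intro powr_mono2) (auto simp: field_simps)
        ultimately have "ennreal (y powr p) \<le> ennreal ((x / 2 ^ k) powr p) * indicator (E k) \<omega>"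
          by (simp add: ennreal_leI)
        also have "\<dots> \<le> (\<Sum>k. ennreal ((x / 2 ^ k) powr p) * indicator (E k) \<omega>)"
          by (rule ennreal_le_suminf)
        finally show ?thesis
          by (simp add: y_def)
      qed
      have layer_prob: "ennreal ((x / 2 ^ k) powr p) * emeasure M (E k) \<le>
          ennreal (K * 2 powr b * x powr p * G * (u powr a + u powr b) * r ^ k)" for k
      proof -
        have "measure M (E k) \<le> K * G * ((u * 2 ^ Suc k) powr a + (u * 2 ^ Suc k) powr b)"
          using tail[of x "u * 2 ^ Suc k"] x u by (simp add: E_def G_def)
        also have "\<dots> \<le> K * G * ((u powr a + u powr b) * (2 ^ Suc k) powr b)"
        proof -
          have "(2 ^ Suc k :: real) powr a \<le> (2 ^ Suc k) powr b"
            using ab by (intro powr_mono) (auto simp: one_le_power intro: order.trans[of 1 "2 ^ k"])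
          then have "u powr a * (2 ^ Suc k) powr a \<le> u powr a * (2 ^ Suc k) powr b"
            by (intro mult_left_mono) auto
          then show ?thesis
            using K G u by (intro mult_left_mono) (auto simp: powr_mult distrib_right)
        qed
        finally have E: "measure M (E k) \<le> K * G * ((u powr a + u powr b) * (2 ^ Suc k) powr b)" .
        have powk: "(2 ^ k) powr s = (2 powr s) ^ k" for s :: real
          by (simp add: powr_realpow[symmetric] powr_powr mult.commute)
        have rk: "(2 powr b) ^ k / (2 powr p) ^ k = r ^ k"
          by (simp add: r_def powr_diff power_divide)
        have "(x / 2 ^ k) powr p * measure M (E k) \<le>
            (x / 2 ^ k) powr p * (K * G * ((u powr a + u powr b) * (2 ^ Suc k) powr b))"
          using E by (intro mult_left_mono) auto
        also have "\<dots> = K * 2 powr b * x powr p * G * (u powr a + u powr b) *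
            ((2 powr b) ^ k / (2 powr p) ^ k)"
          using x by (simp add: powr_mult powr_divide powk)
        finally show ?thesis
          by (simp add: rk emeasure_eq_measure ennreal_leI flip: ennreal_mult)
      qed
      define H where "H = K * 2 powr b * x powr p * G * (u powr a + u powr b)"
      have H: "H \<ge> 0"
        using K G by (simp add: H_def)
      have "(\<integral>\<^sup>+\<omega>. ennreal (min (u * q \<omega>) x powr p) \<partial>M) \<le>
          (\<integral>\<^sup>+\<omega>. (\<Sum>k. ennreal ((x / 2 ^ k) powr p) * indicator (E k) \<omega>) \<partial>M)"
        by (intro nn_integral_mono layer)
      also have "\<dots> = (\<Sum>k. ennreal ((x / 2 ^ k) powr p) * emeasure M (E k))"
        by (subst nn_integral_suminf) (auto simp: nn_integral_cmult)
      also have "\<dots> \<le> (\<Sum>k. ennreal (H * r ^ k))"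
        using layer_prob unfolding H_def by (intro suminf_le) auto
      also have "\<dots> = ennreal (H * (1 / (1 - r)))"
        using H r by (intro suminf_ennreal_eq sums_mult geometric_sums) auto
      also have "\<dots> \<le> ennreal (K' * x powr p * G * (u powr a + u powr b))"
      proof (intro ennreal_leI)
        have "H * (1 / (1 - r)) = K * (2 powr b * x powr p * G * (u powr a + u powr b) / (1 - r))"
          by (simp add: H_def)
        also have "\<dots> \<le> (K + 1) * (2 powr b * x powr p * G * (u powr a + u powr b) / (1 - r))"
          using G r by (intro mult_right_mono) auto
        also have "\<dots> = K' * x powr p * G * (u powr a + u powr b)"
          by (simp add: K'_def)
        finally show "H * (1 / (1 - r)) \<le> K' * x powr p * G * (u powr a + u powr b)" .
      qed
      finally show ?thesis
        by (simp add: G_def)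
    qed
  qed
qed

text \<open>
  The dyadic layers between \<open>2 ^ k\<close> and \<open>2 ^ (k + 2)\<close> contribute to the mean at most a geometric
  series with ratio \<open>2 powr (1 - a)\<close>.
\<close>

lemma (in prob_space) finite_mean_of_tail:
  fixes q :: "'a \<Rightarrow> real"
  assumes [measurable]: "q \<in> borel_measurable M" and K: "K \<ge> 0" and a: "a > 1"
    and tail: "\<And>x. x \<ge> 1 \<Longrightarrow> \<P>(\<omega> in M. q \<omega> > x) \<le> K * x powr (-a)"
  shows "(\<integral>\<^sup>+\<omega>. ennreal (q \<omega>) \<partial>M) < \<infinity>"
proof -
  define r where "r = 2 powr (1 - a)"
  have r: "0 < r" "r < 1"
    using a by (auto simp: r_def powr_less_one)
  define E where "E k = {\<omega> \<in> space M. q \<omega> > 2 ^ k}" for k :: nat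
  have [measurable]: "E k \<in> sets M" for k
    by (simp add: E_def)
  have layer: "ennreal (q \<omega>) \<le> 2 + (\<Sum>k. ennreal (2 ^ Suc (Suc k)) * indicator (E k) \<omega>)"
    if \<omega>: "\<omega> \<in> space M" for \<omega>
  proof (cases "q \<omega> \<le> 2")
    case True
    then have "ennreal (q \<omega>) \<le> ennreal 2"
      by (rule ennreal_leI)
    then show ?thesis
      by (simp add: add_increasing2)
  next
    case False
    then obtain k :: nat where k: "2 ^ k \<le> q \<omega> / 2" "q \<omega> / 2 < 2 ^ Suc k"
      using power_of_two_bracket[of "q \<omega> / 2"] by auto
    have "2 ^ k < q \<omega>"
      using k(1) False by simp
    then have "ennreal (q \<omega>) \<le> ennreal (2 ^ Suc (Suc k)) * indicator (E k) \<omega>"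
      using k(2) \<omega> by (auto simp: E_def intro!: ennreal_leI)
    also have "\<dots> \<le> (\<Sum>k. ennreal (2 ^ Suc (Suc k)) * indicator (E k) \<omega>)"
      by (rule ennreal_le_suminf)
    also have "\<dots> \<le> 2 + (\<Sum>k. ennreal (2 ^ Suc (Suc k)) * indicator (E k) \<omega>)"
      by simp
    finally show ?thesis .
  qed
  have layer_prob: "ennreal (2 ^ Suc (Suc k)) * emeasure M (E k) \<le> ennreal (4 * K * r ^ k)" for k
  proof -
    have "2 ^ Suc (Suc k) * measure M (E k) \<le> 2 ^ Suc (Suc k) * (K * (2 ^ k) powr (-a))"
      using tail[of "2 ^ k"] by (intro mult_left_mono) (auto simp: E_def)
    also have "\<dots> = 4 * K * r ^ k"
      by (simp add: r_def powr_diff powr_minus power_divide powr_realpow[symmetric] powr_powr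
          mult.commute field_simps)
    finally show ?thesis
      by (simp add: emeasure_eq_measure ennreal_leI flip: ennreal_mult)
  qed
  have "(\<integral>\<^sup>+\<omega>. ennreal (q \<omega>) \<partial>M) \<le>
      (\<integral>\<^sup>+\<omega>. 2 + (\<Sum>k. ennreal (2 ^ Suc (Suc k)) * indicator (E k) \<omega>) \<partial>M)"
    by (intro nn_integral_mono layer)
  also have "\<dots> = 2 + (\<Sum>k. ennreal (2 ^ Suc (Suc k)) * emeasure M (E k))"
    by (simp add: nn_integral_add nn_integral_suminf nn_integral_cmult emeasure_space_1)
  also have "\<dots> \<le> 2 + (\<Sum>k. ennreal (4 * K * r ^ k))"
    using layer_prob by (intro add_left_mono suminf_le) auto
  also have "(\<Sum>k. ennreal (4 * K * r ^ k)) = ennreal (4 * K * (1 / (1 - r)))"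
    using K r by (intro suminf_ennreal_eq sums_mult geometric_sums) auto
  also have "2 + \<dots> < \<infinity>"
    by simp
  finally show ?thesis .
qed

section \<open>Trees with independent marks\<close>

text \<open>
  All estimates are made for the finite part of the \<open>n\<close>-th generation whose labels are at most \<open>m\<close>, with
  constants that do not depend on \<open>m\<close>. This avoids all questions of convergence until the very end.
\<close>

definition truncated_generation :: "nat \<Rightarrow> nat \<Rightarrow> nat list set" where
  "truncated_generation m n = {i. set i \<subseteq> {1..m} \<and> length i = n}"

lemma finite_truncated_generation [simp]: "finite (truncated_generation m n)"
  unfolding truncated_generation_def by (rule finite_lists_length_eq) simp

lemma truncated_generation_subset: "truncated_generation m n \<subseteq> tree_nodes"
  by (auto simp: truncated_generation_def tree_nodes_def)

lemma truncated_generation_0 [simp]: "truncated_generation m 0 = {[]}"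
  by (auto simp: truncated_generation_def)

lemma sum_truncated_generation_Suc:
  "(\<Sum>i\<in>truncated_generation m (Suc n). f i) =
     (\<Sum>i\<in>truncated_generation m n. \<Sum>j\<in>{1..m}. f (i @ [j]))"
proof -
  have "bij_betw (\<lambda>(i, j). i @ [j]) (truncated_generation m n \<times> {1..m})
          (truncated_generation m (Suc n))"
  proof (rule bij_betwI')
    fix k assume k: "k \<in> truncated_generation m (Suc n)"
    then have "k \<noteq> []"
      by (auto simp: truncated_generation_def)
    then obtain i j where "k = i @ [j]"
      by (metis append_butlast_last_id)
    then show "\<exists>x\<in>truncated_generation m n \<times> {1..m}. k = (case x of (i, j) \<Rightarrow> i @ [j])"
      using k by (auto simp: truncated_generation_def)
  qed (auto simp: truncated_generation_def)
  from sum.reindex_bij_betw[OF this, of f] show ?thesis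
    by (simp add: sum.cartesian_product case_prod_beta)
qed

text \<open>
  The weight of the path from the root to \<open>i\<close>, as a function of the marks of the proper prefixes of
  \<open>i\<close> only. This is what makes it independent of the marks in the generation of \<open>i\<close> and later.
\<close>

definition weight_along :: "(nat \<Rightarrow> 's \<Rightarrow> real) \<Rightarrow> (nat list \<Rightarrow> 's) \<Rightarrow> nat list \<Rightarrow> real" where
  "weight_along c v i = (\<Prod>k<length i. c (i ! k) (v (take k i)))"

lemma weight_along_Nil [simp]: "weight_along c v [] = 1"
  by (simp add: weight_along_def)

lemma weight_along_snoc [simp]:
  "weight_along c v (i @ [j]) = weight_along c v i * c j (v i)"
  by (simp add: weight_along_def nth_append)

lemma weight_along_cong:
  assumes "\<And>k. k < length i \<Longrightarrow> v (take k i) = v' (take k i)"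
  shows "weight_along c v i = weight_along c v' i"
  unfolding weight_along_def using assms by (intro prod.cong) auto

lemma nn_integral_linear_bound:
  assumes [measurable]:  "f \<in> borel_measurable M" "g \<in> borel_measurable M"
    and "\<And>\<omega>. 0 \<le> f \<omega>" "\<And>\<omega>. 0 \<le> g \<omega>" "0 \<le> a" "0 \<le> b" "0 \<le> A" "0 \<le> B"
    and "(\<integral>\<^sup>+\<omega>. ennreal (f \<omega>) \<partial>M) \<le> ennreal A" "(\<integral>\<^sup>+\<omega>. ennreal (g \<omega>) \<partial>M) \<le> ennreal B"
  shows "(\<integral>\<^sup>+\<omega>. ennreal (a * f \<omega> + b * g \<omega>) \<partial>M) \<le> ennreal (a * A + b * B)"
proof -
  have "(\<integral>\<^sup>+\<omega>. ennreal (a * f \<omega> + b * g \<omega>) \<partial>M) =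
      (\<integral>\<^sup>+\<omega>. ennreal a * ennreal (f \<omega>) + ennreal b * ennreal (g \<omega>) \<partial>M)"
    using assms by (simp add: ennreal_mult ennreal_plus)
  also have "\<dots> = ennreal a * (\<integral>\<^sup>+\<omega>. ennreal (f \<omega>) \<partial>M) + ennreal b * (\<integral>\<^sup>+\<omega>. ennreal (g \<omega>) \<partial>M)"
    by (simp add: nn_integral_add nn_integral_cmult)
  also have "\<dots> \<le> ennreal a * ennreal A + ennreal b * ennreal B"
    using assms by (intro add_mono mult_left_mono) auto
  also have "\<dots> = ennreal (a * A + b * B)"
    using assms by (simp add: ennreal_mult ennreal_plus)
  finally show ?thesis .
qed

text \<open>
  A tree that carries independent and identically distributed marks \<open>V i\<close> in an arbitrary space. The
  edge from \<open>i\<close> to its \<open>j\<close>-th child has weight \<open>c j (V i)\<close>, where weight 0 stands for a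
  missing child, so that the full tree can be used as index set.
\<close>

locale iid_marks = prob_space M for M :: "'a measure" +
  fixes S :: "'s measure" and V :: "nat list \<Rightarrow> 'a \<Rightarrow> 's" and c :: "nat \<Rightarrow> 's \<Rightarrow> real"
  assumes indep: "indep_vars (\<lambda>_. S) V tree_nodes"
    and identical: "\<And>i. i \<in> tree_nodes \<Longrightarrow> distr M S (V i) = distr M S (V [])"
    and c_measurable [measurable]: "\<And>j. c j \<in> borel_measurable S"
    and c_nonneg: "\<And>j s. c j s \<ge> 0"
begin

definition w :: "nat list \<Rightarrow> 'a \<Rightarrow> real" where
  "w i \<omega> = weight_along c (\<lambda>k. V k \<omega>) i"

lemma w_Nil [simp]: "w [] \<omega> = 1"
  by (simp add: w_def)

lemma w_snoc [simp]: "w (i @ [j]) \<omega> = w i \<omega> * c j (V i \<omega>)"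
  by (simp add: w_def)

lemma w_nonneg: "w i \<omega> \<ge> 0"
  by (auto simp: w_def weight_along_def intro!: prod_nonneg c_nonneg)

lemma V_measurable: "i \<in> tree_nodes \<Longrightarrow> V i \<in> measurable M S"
  using indep by (auto simp: indep_vars_def)

lemma Nil_tree_node [simp]: "[] \<in> tree_nodes"
  by (simp add: tree_nodes_def)

lemma V_Nil_measurable [measurable]: "V [] \<in> measurable M S"
  by (simp add: V_measurable)

lemma nn_integral_V:
  assumes "i \<in> tree_nodes" "g \<in> borel_measurable S"
  shows "(\<integral>\<^sup>+\<omega>. g (V i \<omega>) \<partial>M) = (\<integral>\<^sup>+\<omega>. g (V [] \<omega>) \<partial>M)"
proof -
  have law: "(\<integral>\<^sup>+\<omega>. g (V k \<omega>) \<partial>M) = (\<integral>\<^sup>+s. g s \<partial>distr M S (V k))" if "k \<in> tree_nodes" for k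
    using assms(2) V_measurable[OF that] by (subst nn_integral_distr) auto
  show ?thesis
    by (simp only: law[OF assms(1)] law[OF Nil_tree_node] identical[OF assms(1)])
qed

text \<open>
  Marks on disjoint sets of nodes are independent, so their joint law is a product measure and the
  marks on one of the two sets may be replaced by those of an independent copy.
\<close>

lemma nn_integral_decouple:
  assumes AB: "A \<inter> B = {}" "A \<subseteq> tree_nodes" "B \<subseteq> tree_nodes"
    and f: "f \<in> borel_measurable (PiM A (\<lambda>_. S) \<Otimes>\<^sub>M PiM B (\<lambda>_. S))"
  shows "(\<integral>\<^sup>+\<omega>. f (restrict (\<lambda>i. V i \<omega>) A, restrict (\<lambda>i. V i \<omega>) B) \<partial>M) =
    (\<integral>\<^sup>+\<omega>. \<integral>\<^sup>+\<omega>'. f (restrict (\<lambda>i. V i \<omega>) A, restrict (\<lambda>i. V i \<omega>') B) \<partial>M \<partial>M)"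
proof -
  define X where "X \<omega> = restrict (\<lambda>i. V i \<omega>) A" for \<omega>
  define Y where "Y \<omega> = restrict (\<lambda>i. V i \<omega>) B" for \<omega>
  have "indep_var (PiM A (\<lambda>_. S)) X (PiM B (\<lambda>_. S)) Y"
    unfolding X_def Y_def using indep AB by (rule indep_var_restrict)
  then have X [measurable]: "X \<in> measurable M (PiM A (\<lambda>_. S))"
    and Y [measurable]: "Y \<in> measurable M (PiM B (\<lambda>_. S))"
    and eq: "distr M (PiM A (\<lambda>_. S)) X \<Otimes>\<^sub>M distr M (PiM B (\<lambda>_. S)) Y =
      distr M (PiM A (\<lambda>_. S) \<Otimes>\<^sub>M PiM B (\<lambda>_. S)) (\<lambda>\<omega>. (X \<omega>, Y \<omega>))"
    by (auto simp: indep_var_distribution_eq)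
  interpret Y: prob_space "distr M (PiM B (\<lambda>_. S)) Y"
    by (rule prob_space_distr) simp
  note f [measurable]
  have "(\<integral>\<^sup>+\<omega>. f (X \<omega>, Y \<omega>) \<partial>M) =
      (\<integral>\<^sup>+z. f z \<partial>(distr M (PiM A (\<lambda>_. S)) X \<Otimes>\<^sub>M distr M (PiM B (\<lambda>_. S)) Y))"
    unfolding eq by (subst nn_integral_distr) auto
  also have "\<dots> = (\<integral>\<^sup>+x. \<integral>\<^sup>+y. f (x, y) \<partial>distr M (PiM B (\<lambda>_. S)) Y \<partial>distr M (PiM A (\<lambda>_. S)) X)"
    by (intro Y.nn_integral_fst[symmetric]) simp
  also have "\<dots> = (\<integral>\<^sup>+\<omega>. \<integral>\<^sup>+y. f (X \<omega>, y) \<partial>distr M (PiM B (\<lambda>_. S)) Y \<partial>M)"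
    by (subst nn_integral_distr) auto
  also have "\<dots> = (\<integral>\<^sup>+\<omega>. \<integral>\<^sup>+\<omega>'. f (X \<omega>, Y \<omega>') \<partial>M \<partial>M)"
  proof (intro nn_integral_cong)
    fix \<omega> assume "\<omega> \<in> space M"
    then have "X \<omega> \<in> space (PiM A (\<lambda>_. S))"
      by (rule measurable_space[OF X])
    then have "(\<lambda>y. f (X \<omega>, y)) \<in> borel_measurable (PiM B (\<lambda>_. S))"
      by measurable
    then show "(\<integral>\<^sup>+y. f (X \<omega>, y) \<partial>distr M (PiM B (\<lambda>_. S)) Y) = (\<integral>\<^sup>+\<omega>'. f (X \<omega>, Y \<omega>') \<partial>M)"
      by (subst nn_integral_distr) auto
  qed
  finally show ?thesis
    by (simp add: X_def Y_def)
qed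

lemma take_truncated_generation:
  assumes "i \<in> truncated_generation m n" "k < length i"
  shows "take k i \<in> {i \<in> tree_nodes. length i < n}"
  using assms set_take_subset[of k i]
  by (fastforce simp: truncated_generation_def tree_nodes_def)

text \<open>
  Conditioning on all generations before the \<open>n\<close>-th one: the weights \<open>w i\<close> of the nodes in generation
  \<open>n\<close> are functions of the marks in the earlier generations, hence may be treated as constants when
  integrating over the marks in generation \<open>n\<close>.
\<close>

lemma nn_integral_decouple_generation:
  fixes \<psi> :: "real \<Rightarrow> 's \<Rightarrow> real" and H :: "real \<Rightarrow> ennreal"
  assumes \<psi> [measurable]: "(\<lambda>(u, s). \<psi> u s) \<in> borel_measurable (borel \<Otimes>\<^sub>M S)"
    and H [measurable]: "H \<in> borel_measurable borel"
  shows "(\<integral>\<^sup>+\<omega>. H (\<Sum>i\<in>truncated_generation m n. \<psi> (w i \<omega>) (V i \<omega>)) \<partial>M) =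
    (\<integral>\<^sup>+\<omega>. \<integral>\<^sup>+\<omega>'. H (\<Sum>i\<in>truncated_generation m n. \<psi> (w i \<omega>) (V i \<omega>')) \<partial>M \<partial>M)"
proof -
  define A where "A = {i \<in> tree_nodes. length i < n}"
  define B where "B = truncated_generation m n"
  define f where "f = (\<lambda>(x, y). H (\<Sum>i\<in>B. \<psi> (weight_along c x i) (y i)))"
  have w_eq: "weight_along c (restrict (\<lambda>k. V k \<omega>) A) i = w i \<omega>" if "i \<in> B" for i \<omega>
    unfolding w_def using that take_truncated_generation
    by (intro weight_along_cong) (auto simp: A_def B_def)
  have "(\<lambda>x. weight_along c x i) \<in> borel_measurable (PiM A (\<lambda>_. S))" if "i \<in> B" for i
    unfolding weight_along_def using that take_truncated_generation
    by (intro borel_measurable_prod measurable_compose[OF _ c_measurable] measurable_component_singleton)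
      (auto simp: A_def B_def)
  note this [measurable]
  have "(\<lambda>z. \<psi> (weight_along c (fst z) i) (snd z i)) \<in>
      borel_measurable (PiM A (\<lambda>_. S) \<Otimes>\<^sub>M PiM B (\<lambda>_. S))" if i [measurable]: "i \<in> B" for i
  proof -
    have "(\<lambda>z. (weight_along c (fst z) i, snd z i)) \<in>
        measurable (PiM A (\<lambda>_. S) \<Otimes>\<^sub>M PiM B (\<lambda>_. S)) (borel \<Otimes>\<^sub>M S)"
      by measurable
    from measurable_compose[OF this \<psi>] show ?thesis
      by simp
  qed
  then have "f \<in> borel_measurable (PiM A (\<lambda>_. S) \<Otimes>\<^sub>M PiM B (\<lambda>_. S))"
    unfolding f_def case_prod_beta by (intro measurable_compose[OF _ H] borel_measurable_sum) auto
  moreover have "A \<inter> B = {}" "A \<subseteq> tree_nodes" "B \<subseteq> tree_nodes"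
    using truncated_generation_subset by (auto simp: A_def B_def truncated_generation_def)
  ultimately have "(\<integral>\<^sup>+\<omega>. f (restrict (\<lambda>i. V i \<omega>) A, restrict (\<lambda>i. V i \<omega>) B) \<partial>M) =
    (\<integral>\<^sup>+\<omega>. \<integral>\<^sup>+\<omega>'. f (restrict (\<lambda>i. V i \<omega>) A, restrict (\<lambda>i. V i \<omega>') B) \<partial>M \<partial>M)"
    by (intro nn_integral_decouple)
  then show ?thesis
    by (simp add: f_def w_eq B_def[symmetric] cong: sum.cong)
qed

lemma w_measurable [measurable]:
  assumes "i \<in> truncated_generation m n"
  shows "w i \<in> borel_measurable M"
proof -
  have "(\<lambda>\<omega>. c (i ! k) (V (take k i) \<omega>)) \<in> borel_measurable M" if "k < length i" for k
    using take_truncated_generation[OF assms that]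
    by (intro measurable_compose[OF V_measurable c_measurable]) auto
  then show ?thesis
    unfolding w_def weight_along_def by (intro borel_measurable_prod) auto
qed

text \<open>
  Conditionally on the earlier generations, the power sum over the children of a node is the power
  of the node's own weight times a factor with mean at most \<open>r\<close>.
\<close>

lemma weight_power_sum_le:
  assumes r: "r \<ge> 0"
    and le: "\<And>m. (\<integral>\<^sup>+\<omega>. ennreal (\<Sum>j\<in>{1..m}. c j (V [] \<omega>) powr \<beta>) \<partial>M) \<le> ennreal r"
  shows "(\<integral>\<^sup>+\<omega>. ennreal (\<Sum>i\<in>truncated_generation m n. w i \<omega> powr \<beta>) \<partial>M) \<le> ennreal (r ^ n)"
proof (induction n)
  case 0
  then show ?case
    by (simp add: emeasure_space_1)
next
  case (Suc n)
  define T where "T = truncated_generation m n"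
  define Y where "Y s = (\<Sum>j\<in>{1..m}. c j s powr \<beta>)" for s
  have Y_nonneg: "Y s \<ge> 0" for s
    unfolding Y_def by (intro sum_nonneg) auto
  have Y [measurable]: "Y \<in> borel_measurable S"
    unfolding Y_def by measurable
  have Y_le: "(\<integral>\<^sup>+\<omega>. ennreal (Y (V i \<omega>)) \<partial>M) \<le> ennreal r" if "i \<in> T" for i
  proof -
    have "i \<in> tree_nodes"
      using that truncated_generation_subset by (auto simp: T_def)
    then show ?thesis
      using le[of m] nn_integral_V[of i "\<lambda>s. ennreal (Y s)"] by (simp add: Y_def)
  qed
  have V [measurable]: "V i \<in> measurable M S" if "i \<in> T" for i
    using that truncated_generation_subset by (intro V_measurable) (auto simp: T_def)
  have "(\<Sum>i\<in>truncated_generation m (Suc n). w i \<omega> powr \<beta>) =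
      (\<Sum>i\<in>T. w i \<omega> powr \<beta> * Y (V i \<omega>))" for \<omega>
    by (simp add: sum_truncated_generation_Suc T_def Y_def powr_mult w_nonneg c_nonneg sum_distrib_left)
  then have "(\<integral>\<^sup>+\<omega>. ennreal (\<Sum>i\<in>truncated_generation m (Suc n). w i \<omega> powr \<beta>) \<partial>M) =
      (\<integral>\<^sup>+\<omega>. ennreal (\<Sum>i\<in>T. w i \<omega> powr \<beta> * Y (V i \<omega>)) \<partial>M)"
    by simp
  also have "\<dots> = (\<integral>\<^sup>+\<omega>. \<integral>\<^sup>+\<omega>'. ennreal (\<Sum>i\<in>T. w i \<omega> powr \<beta> * Y (V i \<omega>')) \<partial>M \<partial>M)"
    unfolding T_def by (rule nn_integral_decouple_generation) measurable
  also have "\<dots> \<le> (\<integral>\<^sup>+\<omega>. ennreal r * ennreal (\<Sum>i\<in>T. w i \<omega> powr \<beta>) \<partial>M)"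
  proof (intro nn_integral_mono)
    fix \<omega>
    have "(\<integral>\<^sup>+\<omega>'. ennreal (\<Sum>i\<in>T. w i \<omega> powr \<beta> * Y (V i \<omega>')) \<partial>M) =
        (\<integral>\<^sup>+\<omega>'. (\<Sum>i\<in>T. ennreal (w i \<omega> powr \<beta>) * ennreal (Y (V i \<omega>'))) \<partial>M)"
      by (simp add: Y_nonneg flip: ennreal_mult)
    also have "\<dots> = (\<Sum>i\<in>T. ennreal (w i \<omega> powr \<beta>) * (\<integral>\<^sup>+\<omega>'. ennreal (Y (V i \<omega>')) \<partial>M))"
      by (simp add: nn_integral_sum nn_integral_cmult)
    also have "\<dots> \<le> (\<Sum>i\<in>T. ennreal (w i \<omega> powr \<beta>) * ennreal r)"
      using Y_le by (intro sum_mono mult_left_mono) auto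
    also have "\<dots> = (\<Sum>i\<in>T. ennreal (w i \<omega> powr \<beta>)) * ennreal r"
      by (rule sum_distrib_right[symmetric])
    also have "\<dots> = ennreal r * ennreal (\<Sum>i\<in>T. w i \<omega> powr \<beta>)"
      by (simp add: mult.commute)
    finally show "(\<integral>\<^sup>+\<omega>'. ennreal (\<Sum>i\<in>T. w i \<omega> powr \<beta> * Y (V i \<omega>')) \<partial>M) \<le>
        ennreal r * ennreal (\<Sum>i\<in>T. w i \<omega> powr \<beta>)" .
  qed
  also have "\<dots> = ennreal r * (\<integral>\<^sup>+\<omega>. ennreal (\<Sum>i\<in>T. w i \<omega> powr \<beta>) \<partial>M)"
    unfolding T_def by (intro nn_integral_cmult) measurable
  also have "\<dots> \<le> ennreal r * ennreal (r ^ n)"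
    using Suc by (intro mult_left_mono) (auto simp: T_def)
  also have "\<dots> = ennreal (r ^ Suc n)"
    using r by (simp add: ennreal_mult)
  finally show ?case .
qed

text \<open>
  Rosenthal's inequality conditionally on the weights, applied to the independent terms
  \<open>\<psi> (w i) (V i)\<close> of one generation. Here \<open>hp\<close> and \<open>h1\<close> bound the \<open>p\<close>-th and first moments of a
  term as functions of its weight.
\<close>

lemma rosenthal_generation:
  fixes \<psi> :: "real \<Rightarrow> 's \<Rightarrow> real" and hp h1 :: "real \<Rightarrow> real"
  assumes p: "p > 1" and \<delta>: "\<delta> > 0"
    and \<psi> [measurable]: "(\<lambda>(u, s). \<psi> u s) \<in> borel_measurable (borel \<Otimes>\<^sub>M S)"
    and nonneg: "\<And>u s. u \<ge> 0 \<Longrightarrow> 0 \<le> \<psi> u s"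
      "\<And>u. u \<ge> 0 \<Longrightarrow> 0 \<le> hp u" "\<And>u. u \<ge> 0 \<Longrightarrow> 0 \<le> h1 u"
    and hp: "\<And>u. u \<ge> 0 \<Longrightarrow> (\<integral>\<^sup>+\<omega>. ennreal (\<psi> u (V [] \<omega>) powr p) \<partial>M) \<le> ennreal (hp u)"
    and h1: "\<And>u. u \<ge> 0 \<Longrightarrow> (\<integral>\<^sup>+\<omega>. ennreal (\<psi> u (V [] \<omega>)) \<partial>M) \<le> ennreal (h1 u)"
  shows "(\<integral>\<^sup>+\<omega>. ennreal ((\<Sum>i\<in>truncated_generation m n. \<psi> (w i \<omega>) (V i \<omega>)) powr p) \<partial>M) \<le>
    (\<integral>\<^sup>+\<omega>. ennreal (rosenthal_const p \<delta> * (\<Sum>i\<in>truncated_generation m n. hp (w i \<omega>)) +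
        (1 + \<delta>) * (\<Sum>i\<in>truncated_generation m n. h1 (w i \<omega>)) powr p) \<partial>M)"
proof -
  define T where "T = truncated_generation m n"
  have T: "finite T" "T \<subseteq> tree_nodes"
    using truncated_generation_subset by (auto simp: T_def)
  have [measurable]: "\<psi> u \<in> borel_measurable S" for u
    using measurable_compose[OF measurable_Pair1' \<psi>, of u] by simp
  have "(\<integral>\<^sup>+\<omega>. ennreal ((\<Sum>i\<in>T. \<psi> (w i \<omega>) (V i \<omega>)) powr p) \<partial>M) =
      (\<integral>\<^sup>+\<omega>. \<integral>\<^sup>+\<omega>'. ennreal ((\<Sum>i\<in>T. \<psi> (w i \<omega>) (V i \<omega>')) powr p) \<partial>M \<partial>M)"
    unfolding T_def by (rule nn_integral_decouple_generation[OF \<psi>]) measurable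
  also have "\<dots> \<le> (\<integral>\<^sup>+\<omega>. ennreal (rosenthal_const p \<delta> * (\<Sum>i\<in>T. hp (w i \<omega>)) +
        (1 + \<delta>) * (\<Sum>i\<in>T. h1 (w i \<omega>)) powr p) \<partial>M)"
  proof (intro nn_integral_mono rosenthal[OF p \<delta> T(1)])
    fix \<omega>
    show "indep_vars (\<lambda>_. borel) (\<lambda>i \<omega>'. \<psi> (w i \<omega>) (V i \<omega>')) T"
      using indep_vars_subset[OF indep T(2)] by (rule indep_vars_compose2) simp
    fix i assume "i \<in> T"
    then have i: "i \<in> tree_nodes"
      using T by auto
    show "(\<integral>\<^sup>+\<omega>'. ennreal (\<psi> (w i \<omega>) (V i \<omega>') powr p) \<partial>M) \<le> ennreal (hp (w i \<omega>))"
      using nn_integral_V[OF i, of "\<lambda>s. ennreal (\<psi> (w i \<omega>) s powr p)"] hp w_nonneg by simp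
    show "(\<integral>\<^sup>+\<omega>'. ennreal (\<psi> (w i \<omega>) (V i \<omega>')) \<partial>M) \<le> ennreal (h1 (w i \<omega>))"
      using nn_integral_V[OF i, of "\<lambda>s. ennreal (\<psi> (w i \<omega>) s)"] h1 w_nonneg by simp
  qed (use nonneg w_nonneg in auto)
  finally show ?thesis
    by (simp add: T_def)
qed

section \<open>Moments of the total weight of a generation\<close>

text \<open>
  The total weight of generation \<open>n + 1\<close> is a sum over generation \<open>n\<close> of the weights multiplied by
  independent copies of the total weight of the root's children. For the \<open>p\<close>-th moment \<open>a n\<close> of the
  total weight of generation \<open>n\<close>, Rosenthal's inequality therefore yields
  \<open>a (n + 1) \<le> K * B * r ^ n + (1 + \<delta>) * r powr p * a n\<close>. Since \<open>r powr p \<le> r < \<eta>\<close>, a small \<open>\<delta>\<close> makes the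
  second coefficient at most \<open>s < \<eta>\<close>, and then \<open>a n \<le> K' * \<eta> ^ n\<close> follows by induction as soon as
  \<open>K * B \<le> K' * (\<eta> - s)\<close>.
\<close>

lemma weight_sum_moment_le:
  assumes p: "p > 1" and r: "0 < r" "r < \<eta>" "\<eta> < 1" and B: "B \<ge> 0"
    and mean: "\<And>m. (\<integral>\<^sup>+\<omega>. ennreal (\<Sum>j\<in>{1..m}. c j (V [] \<omega>)) \<partial>M) \<le> ennreal r"
    and power: "\<And>m. (\<integral>\<^sup>+\<omega>. ennreal (\<Sum>j\<in>{1..m}. c j (V [] \<omega>) powr p) \<partial>M) \<le> ennreal r"
    and moment: "\<And>m. (\<integral>\<^sup>+\<omega>. ennreal ((\<Sum>j\<in>{1..m}. c j (V [] \<omega>)) powr p) \<partial>M) \<le> ennreal B"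
  shows "\<exists>K>0. \<forall>m n.
    (\<integral>\<^sup>+\<omega>. ennreal ((\<Sum>i\<in>truncated_generation m n. w i \<omega>) powr p) \<partial>M) \<le> ennreal (K * \<eta> ^ n)"
proof -
  define s where "s = (r + \<eta>) / 2"
  have s: "r < s" "s < \<eta>"
    using r by (auto simp: s_def)
  define \<delta> where "\<delta> = s / r - 1"
  have \<delta>: "\<delta> > 0" "(1 + \<delta>) * r = s"
    using r s by (auto simp: \<delta>_def)
  define K where "K = rosenthal_const p \<delta>"
  have K: "K > 0"
    using rosenthal_const_pos[OF p \<delta>(1)] by (simp add: K_def)
  define K' where "K' = 1 + K * B / (\<eta> - s)"
  have K': "K' \<ge> 1" "K * B \<le> K' * (\<eta> - s)"
    using K B s by (auto simp: K'_def distrib_right)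
  show ?thesis
  proof (intro exI[of _ K'] conjI allI)
    show "K' > 0"
      using K' by simp
    fix m n
    show "(\<integral>\<^sup>+\<omega>. ennreal ((\<Sum>i\<in>truncated_generation m n. w i \<omega>) powr p) \<partial>M) \<le> ennreal (K' * \<eta> ^ n)"
    proof (induction n)
      case 0
      then show ?case
        using K' by (simp add: emeasure_space_1)
    next
      case (Suc n)
      define T where "T = truncated_generation m n"
      define Y where "Y s = (\<Sum>j\<in>{1..m}. c j s)" for s
      have Y_nonneg: "Y s \<ge> 0" for s
        unfolding Y_def by (intro sum_nonneg c_nonneg)
      have Y [measurable]: "Y \<in> borel_measurable S"
        unfolding Y_def by measurable
      have [measurable]: "w i \<in> borel_measurable M" if "i \<in> T" for i
        using that by (simp add: T_def w_measurable)
      have "(\<Sum>i\<in>truncated_generation m (Suc n). w i \<omega>) = (\<Sum>i\<in>T. w i \<omega> * Y (V i \<omega>))" for \<omega>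
        by (simp add: sum_truncated_generation_Suc T_def Y_def sum_distrib_left)
      then have "(\<integral>\<^sup>+\<omega>. ennreal ((\<Sum>i\<in>truncated_generation m (Suc n). w i \<omega>) powr p) \<partial>M) =
          (\<integral>\<^sup>+\<omega>. ennreal ((\<Sum>i\<in>T. w i \<omega> * Y (V i \<omega>)) powr p) \<partial>M)"
        by simp
      also have "\<dots> \<le> (\<integral>\<^sup>+\<omega>. ennreal (K * (\<Sum>i\<in>T. B * w i \<omega> powr p) +
          (1 + \<delta>) * (\<Sum>i\<in>T. r * w i \<omega>) powr p) \<partial>M)"
        unfolding T_def K_def
      proof (rule rosenthal_generation[OF p \<delta>(1)])
        show "(\<lambda>(u, s). u * Y s) \<in> borel_measurable (borel \<Otimes>\<^sub>M S)"
          by measurable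
        fix u :: real assume u: "u \<ge> 0"
        have "(\<integral>\<^sup>+\<omega>. ennreal ((u * Y (V [] \<omega>)) powr p) \<partial>M) =
            ennreal (u powr p) * (\<integral>\<^sup>+\<omega>. ennreal (Y (V [] \<omega>) powr p) \<partial>M)"
          using u by (simp add: powr_mult Y_nonneg ennreal_mult nn_integral_cmult)
        also have "\<dots> \<le> ennreal (u powr p) * ennreal B"
          unfolding Y_def using moment by (intro mult_left_mono) auto
        finally show "(\<integral>\<^sup>+\<omega>. ennreal ((u * Y (V [] \<omega>)) powr p) \<partial>M) \<le> ennreal (B * u powr p)"
          using B by (simp add: ennreal_mult mult.commute)
        have "(\<integral>\<^sup>+\<omega>. ennreal (u * Y (V [] \<omega>)) \<partial>M) = ennreal u * (\<integral>\<^sup>+\<omega>. ennreal (Y (V [] \<omega>)) \<partial>M)"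
          using u by (simp add: Y_nonneg ennreal_mult nn_integral_cmult)
        also have "\<dots> \<le> ennreal u * ennreal r"
          unfolding Y_def using mean by (intro mult_left_mono) auto
        finally show "(\<integral>\<^sup>+\<omega>. ennreal (u * Y (V [] \<omega>)) \<partial>M) \<le> ennreal (r * u)"
          using u r by (simp add: ennreal_mult mult.commute)
      qed (use B r Y_nonneg in auto)
      also have "\<dots> = (\<integral>\<^sup>+\<omega>. ennreal (K * B * (\<Sum>i\<in>T. w i \<omega> powr p) +
          ((1 + \<delta>) * r powr p) * (\<Sum>i\<in>T. w i \<omega>) powr p) \<partial>M)"
        using r w_nonneg by (simp add: sum_distrib_left[symmetric] powr_mult sum_nonneg mult.assoc)
      also have "\<dots> \<le> ennreal (K * B * r ^ n + ((1 + \<delta>) * r powr p) * (K' * \<eta> ^ n))"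
      proof (rule nn_integral_linear_bound)
        show "(\<integral>\<^sup>+\<omega>. ennreal (\<Sum>i\<in>T. w i \<omega> powr p) \<partial>M) \<le> ennreal (r ^ n)"
          unfolding T_def using r power by (intro weight_power_sum_le) auto
        show "(\<integral>\<^sup>+\<omega>. ennreal ((\<Sum>i\<in>T. w i \<omega>) powr p) \<partial>M) \<le> ennreal (K' * \<eta> ^ n)"
          unfolding T_def by (rule Suc)
        show "0 \<le> K * B" "0 \<le> (1 + \<delta>) * r powr p" "0 \<le> r ^ n" "0 \<le> K' * \<eta> ^ n"
          using K B \<delta> r K' by auto
      qed (auto intro!: sum_nonneg)
      also have "\<dots> \<le> ennreal (K' * \<eta> ^ Suc n)"
      proof (rule ennreal_leI)
        have "r powr p \<le> r powr 1"
          using p r(1) less_trans[OF r(2,3)] by (intro powr_mono') linarith+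
        then have "(1 + \<delta>) * r powr p \<le> (1 + \<delta>) * r"
          using \<delta>(1) r(1) by (intro mult_left_mono) simp_all
        then have coeff: "(1 + \<delta>) * r powr p \<le> s"
          by (simp only: \<delta>(2))
        have "K * B * r ^ n \<le> K' * (\<eta> - s) * \<eta> ^ n"
          using K'(2) by (rule mult_mono[OF _ power_mono]) (use r s K' in simp_all)
        moreover have "(1 + \<delta>) * r powr p * (K' * \<eta> ^ n) \<le> s * (K' * \<eta> ^ n)"
          using coeff by (rule mult_right_mono) (use r K' in simp)
        ultimately have "K * B * r ^ n + (1 + \<delta>) * r powr p * (K' * \<eta> ^ n) \<le>
            K' * (\<eta> - s) * \<eta> ^ n + s * (K' * \<eta> ^ n)"
          by (rule add_mono)
        then show "K * B * r ^ n + (1 + \<delta>) * r powr p * (K' * \<eta> ^ n) \<le> K' * \<eta> ^ Suc n"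
          by (simp add: algebra_simps)
      qed
      finally show ?case .
    qed
  qed
qed


section \<open>The tail of a weighted sum over a generation\<close>

text \<open>
  The sum exceeds \<open>x\<close> only if the sum \<open>\<Sum>i. min (w i * q (V i)) x\<close> of the truncated terms is at least
  \<open>x\<close>: this is clear if no term is truncated, and otherwise a single truncated term already equals \<open>x\<close>.
  By Markov's inequality it suffices to bound the \<open>p\<close>-th moment of the truncated sum, and conditional on
  the weights this is a task for Rosenthal's inequality. The moments of the single terms contribute a
  multiple of \<open>x powr p * G x\<close>, which is the effect of one big term; the power of the mean
  contributes only a constant, which is negligible as \<open>p\<close> exceeds the index of the tail.
\<close>

lemma generation_tail_le:
  fixes q :: "'s \<Rightarrow> real" and G :: "real \<Rightarrow> real"
  assumes p: "p > 1" and q [measurable]: "q \<in> borel_measurable S" and q_nonneg: "\<And>s. q s \<ge> 0"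
    and nonneg: "A \<ge> 0" "\<mu> \<ge> 0" "D \<ge> 0" "\<eta> \<ge> 0" "G x \<ge> 0"
    and trunc: "\<And>u. u \<ge> 0 \<Longrightarrow> (\<integral>\<^sup>+\<omega>. ennreal (min (u * q (V [] \<omega>)) x powr p) \<partial>M) \<le>
        ennreal (A * x powr p * G x * (u powr a + u powr b))"
    and mean: "(\<integral>\<^sup>+\<omega>. ennreal (q (V [] \<omega>)) \<partial>M) \<le> ennreal \<mu>"
    and a: "\<And>m. (\<integral>\<^sup>+\<omega>. ennreal (\<Sum>j\<in>{1..m}. c j (V [] \<omega>) powr a) \<partial>M) \<le> ennreal \<eta>"
    and b: "\<And>m. (\<integral>\<^sup>+\<omega>. ennreal (\<Sum>j\<in>{1..m}. c j (V [] \<omega>) powr b) \<partial>M) \<le> ennreal \<eta>"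
    and D: "(\<integral>\<^sup>+\<omega>. ennreal ((\<Sum>i\<in>truncated_generation m n. w i \<omega>) powr p) \<partial>M) \<le> ennreal (D * \<eta> ^ n)"
    and x: "x > 0" and B: "x powr (-p) \<le> B * G x"
  shows "emeasure M {\<omega> \<in> space M. (\<Sum>i\<in>truncated_generation m n. w i \<omega> * q (V i \<omega>)) > x} \<le>
    ennreal ((2 * rosenthal_const p 1 * A + 2 * \<mu> powr p * D * B) * \<eta> ^ n * G x)"
proof -
  define T where "T = truncated_generation m n"
  define R where "R = rosenthal_const p 1"
  have R: "R > 0"
    using rosenthal_const_pos[OF p, of 1] by (simp add: R_def)
  have T: "finite T"
    by (simp add: T_def)
  have [measurable]: "w i \<in> borel_measurable M" if "i \<in> T" for i
    using that by (simp add: T_def w_measurable)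
  have [measurable]: "V i \<in> measurable M S" if "i \<in> T" for i
    using that truncated_generation_subset by (intro V_measurable) (auto simp: T_def)
  define \<psi> where "\<psi> u s = min (u * q s) x" for u s
  define E where "E = {\<omega> \<in> space M. (\<Sum>i\<in>T. w i \<omega> * q (V i \<omega>)) > x}"
  have E [measurable]: "E \<in> sets M"
    unfolding E_def by measurable
  have \<psi>_nonneg: "0 \<le> \<psi> u s" if "u \<ge> 0" for u s
    using that x q_nonneg by (simp add: \<psi>_def)
  have truncated_sum: "x \<le> (\<Sum>i\<in>T. \<psi> (w i \<omega>) (V i \<omega>))" if "\<omega> \<in> E" for \<omega>
  proof (cases "\<exists>k\<in>T. w k \<omega> * q (V k \<omega>) \<ge> x")
    case True
    then obtain k where k: "k \<in> T" "\<psi> (w k \<omega>) (V k \<omega>) = x"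
      by (auto simp: \<psi>_def)
    then show ?thesis
      using member_le_sum[OF k(1), of "\<lambda>i. \<psi> (w i \<omega>) (V i \<omega>)"] T \<psi>_nonneg w_nonneg by auto
  next
    case False
    then have "(\<Sum>i\<in>T. \<psi> (w i \<omega>) (V i \<omega>)) = (\<Sum>i\<in>T. w i \<omega> * q (V i \<omega>))"
      by (intro sum.cong) (auto simp: \<psi>_def min_def)
    then show ?thesis
      using that by (simp add: E_def)
  qed
  have "emeasure M E = (\<integral>\<^sup>+\<omega>. indicator E \<omega> \<partial>M)"
    by simp
  also have "\<dots> \<le> (\<integral>\<^sup>+\<omega>. ennreal (x powr (-p)) * ennreal ((\<Sum>i\<in>T. \<psi> (w i \<omega>) (V i \<omega>)) powr p) \<partial>M)"
  proof (intro nn_integral_mono)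
    fix \<omega>
    show "indicator E \<omega> \<le> ennreal (x powr (-p)) * ennreal ((\<Sum>i\<in>T. \<psi> (w i \<omega>) (V i \<omega>)) powr p)"
    proof (cases "\<omega> \<in> E")
      case True
      have "1 = x powr (-p) * x powr p"
        using x by (simp flip: powr_add)
      also have "\<dots> \<le> x powr (-p) * (\<Sum>i\<in>T. \<psi> (w i \<omega>) (V i \<omega>)) powr p"
        using truncated_sum[OF True] x p by (intro mult_left_mono powr_mono2) auto
      finally show ?thesis
        using True by (simp flip: ennreal_mult)
    qed simp
  qed
  also have "\<dots> = ennreal (x powr (-p)) * (\<integral>\<^sup>+\<omega>. ennreal ((\<Sum>i\<in>T. \<psi> (w i \<omega>) (V i \<omega>)) powr p) \<partial>M)"
    unfolding \<psi>_def by (intro nn_integral_cmult) measurable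
  also have "\<dots> \<le> ennreal (x powr (-p)) *
      ennreal (R * A * x powr p * G x * (2 * \<eta> ^ n) + 2 * \<mu> powr p * (D * \<eta> ^ n))"
  proof (intro mult_left_mono)
    have "(\<integral>\<^sup>+\<omega>. ennreal ((\<Sum>i\<in>T. \<psi> (w i \<omega>) (V i \<omega>)) powr p) \<partial>M) \<le>
        (\<integral>\<^sup>+\<omega>. ennreal (R * (\<Sum>i\<in>T. A * x powr p * G x * (w i \<omega> powr a + w i \<omega> powr b)) +
          (1 + 1) * (\<Sum>i\<in>T. \<mu> * w i \<omega>) powr p) \<partial>M)"
      unfolding T_def R_def
    proof (rule rosenthal_generation[OF p])
      show "(\<lambda>(u, s). \<psi> u s) \<in> borel_measurable (borel \<Otimes>\<^sub>M S)"
        unfolding \<psi>_def by measurable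
      fix u :: real assume u: "u \<ge> 0"
      show "(\<integral>\<^sup>+\<omega>. ennreal (\<psi> u (V [] \<omega>) powr p) \<partial>M) \<le>
          ennreal (A * x powr p * G x * (u powr a + u powr b))"
        using trunc[OF u] by (simp add: \<psi>_def)
      have "(\<integral>\<^sup>+\<omega>. ennreal (\<psi> u (V [] \<omega>)) \<partial>M) \<le> (\<integral>\<^sup>+\<omega>. ennreal u * ennreal (q (V [] \<omega>)) \<partial>M)"
        using u q_nonneg by (intro nn_integral_mono) (simp add: \<psi>_def ennreal_leI flip: ennreal_mult)
      also have "\<dots> = ennreal u * (\<integral>\<^sup>+\<omega>. ennreal (q (V [] \<omega>)) \<partial>M)"
        by (intro nn_integral_cmult) measurable
      also have "\<dots> \<le> ennreal u * ennreal \<mu>"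
        using mean by (intro mult_left_mono) auto
      finally show "(\<integral>\<^sup>+\<omega>. ennreal (\<psi> u (V [] \<omega>)) \<partial>M) \<le> ennreal (\<mu> * u)"
        using u nonneg by (simp add: ennreal_mult mult.commute)
    qed (use nonneg \<psi>_nonneg in auto)
    also have "\<dots> = (\<integral>\<^sup>+\<omega>. ennreal (R * A * x powr p * G x * (\<Sum>i\<in>T. w i \<omega> powr a + w i \<omega> powr b) +
          2 * \<mu> powr p * (\<Sum>i\<in>T. w i \<omega>) powr p) \<partial>M)"
    proof -
      have "(\<Sum>i\<in>T. A * x powr p * G x * (w i \<omega> powr a + w i \<omega> powr b)) =
          A * x powr p * G x * (\<Sum>i\<in>T. w i \<omega> powr a + w i \<omega> powr b)"
        "(\<Sum>i\<in>T. \<mu> * w i \<omega>) = \<mu> * (\<Sum>i\<in>T. w i \<omega>)" for \<omega>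
        by (rule sum_distrib_left[symmetric])+
      then show ?thesis
        using nonneg w_nonneg by (simp add: powr_mult sum_nonneg mult.assoc)
    qed
    also have "\<dots> \<le> ennreal (R * A * x powr p * G x * (2 * \<eta> ^ n) + 2 * \<mu> powr p * (D * \<eta> ^ n))"
    proof (rule nn_integral_linear_bound)
      have "(\<integral>\<^sup>+\<omega>. ennreal (\<Sum>i\<in>T. w i \<omega> powr a + w i \<omega> powr b) \<partial>M) =
          (\<integral>\<^sup>+\<omega>. ennreal (1 * (\<Sum>i\<in>T. w i \<omega> powr a) + 1 * (\<Sum>i\<in>T. w i \<omega> powr b)) \<partial>M)"
        by (simp only: sum.distrib mult_1)
      also have "\<dots> \<le> ennreal (1 * \<eta> ^ n + 1 * \<eta> ^ n)"
        using weight_power_sum_le[OF nonneg(4) a, of m n] weight_power_sum_le[OF nonneg(4) b, of m n]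
          nonneg unfolding T_def[symmetric]
        by (intro nn_integral_linear_bound) (auto intro!: sum_nonneg)
      finally show "(\<integral>\<^sup>+\<omega>. ennreal (\<Sum>i\<in>T. w i \<omega> powr a + w i \<omega> powr b) \<partial>M) \<le> ennreal (2 * \<eta> ^ n)"
        by simp
      show "(\<integral>\<^sup>+\<omega>. ennreal ((\<Sum>i\<in>T. w i \<omega>) powr p) \<partial>M) \<le> ennreal (D * \<eta> ^ n)"
        unfolding T_def by (rule D)
      show "0 \<le> R * A * x powr p * G x" "0 \<le> 2 * \<mu> powr p" "0 \<le> 2 * \<eta> ^ n" "0 \<le> D * \<eta> ^ n"
        using R nonneg by auto
    qed (auto intro!: sum_nonneg)
    finally show "(\<integral>\<^sup>+\<omega>. ennreal ((\<Sum>i\<in>T. \<psi> (w i \<omega>) (V i \<omega>)) powr p) \<partial>M) \<le>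
        ennreal (R * A * x powr p * G x * (2 * \<eta> ^ n) + 2 * \<mu> powr p * (D * \<eta> ^ n))" .
  qed simp
  also have "\<dots> = ennreal (x powr (-p) *
      (R * A * x powr p * G x * (2 * \<eta> ^ n) + 2 * \<mu> powr p * (D * \<eta> ^ n)))"
    using R nonneg by (intro ennreal_mult[symmetric]) auto
  also have "\<dots> \<le> ennreal ((2 * R * A + 2 * \<mu> powr p * D * B) * \<eta> ^ n * G x)"
  proof (rule ennreal_leI)
    have "x powr (-p) * x powr p = 1"
      using x by (simp flip: powr_add)
    then have "x powr (-p) * (R * A * x powr p * G x * (2 * \<eta> ^ n) + 2 * \<mu> powr p * (D * \<eta> ^ n)) =
        2 * R * A * \<eta> ^ n * G x + x powr (-p) * (2 * \<mu> powr p * (D * \<eta> ^ n))"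
      by (simp add: distrib_left mult.assoc)
    also have "\<dots> \<le> 2 * R * A * \<eta> ^ n * G x + (B * G x) * (2 * \<mu> powr p * (D * \<eta> ^ n))"
      using B nonneg by (intro add_left_mono mult_right_mono) auto
    finally show "x powr (-p) * (R * A * x powr p * G x * (2 * \<eta> ^ n) + 2 * \<mu> powr p * (D * \<eta> ^ n)) \<le>
        (2 * R * A + 2 * \<mu> powr p * D * B) * \<eta> ^ n * G x"
      by (simp add: algebra_simps)
  qed
  finally show ?thesis
    by (simp add: E_def T_def R_def)
qed

text \<open>
  Convexity of \<open>\<beta> \<mapsto> z powr \<beta>\<close> carries over to the expected sum of the \<open>\<beta>\<close>-th powers of the
  weights. It extends bounds for two exponents to all exponents between them.
\<close>

lemma weight_power_interpolation:
  assumes "0 \<le> \<theta>" "\<theta> \<le> 1" "0 \<le> X" "0 \<le> Y"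
    and "(\<integral>\<^sup>+\<omega>. ennreal (\<Sum>j\<in>J. c j (V [] \<omega>) powr s) \<partial>M) \<le> ennreal X"
    and "(\<integral>\<^sup>+\<omega>. ennreal (\<Sum>j\<in>J. c j (V [] \<omega>) powr t) \<partial>M) \<le> ennreal Y"
  shows "(\<integral>\<^sup>+\<omega>. ennreal (\<Sum>j\<in>J. c j (V [] \<omega>) powr ((1 - \<theta>) * s + \<theta> * t)) \<partial>M) \<le>
    ennreal ((1 - \<theta>) * X + \<theta> * Y)"
proof -
  have "(\<integral>\<^sup>+\<omega>. ennreal (\<Sum>j\<in>J. c j (V [] \<omega>) powr ((1 - \<theta>) * s + \<theta> * t)) \<partial>M) \<le>
      (\<integral>\<^sup>+\<omega>. ennreal ((1 - \<theta>) * (\<Sum>j\<in>J. c j (V [] \<omega>) powr s) +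
        \<theta> * (\<Sum>j\<in>J. c j (V [] \<omega>) powr t)) \<partial>M)"
    using assms unfolding sum_distrib_left sum.distrib[symmetric]
    by (intro nn_integral_mono ennreal_leI sum_mono powr_interpolation c_nonneg)
  also have "\<dots> \<le> ennreal ((1 - \<theta>) * X + \<theta> * Y)"
    using assms by (intro nn_integral_linear_bound) (auto intro!: sum_nonneg)
  finally show ?thesis .
qed

text \<open>
  The choice of exponents. Convexity in the exponent, between \<open>\<alpha>\<close> and \<open>\<alpha> + \<epsilon>\<close>, shows that the power sum
  stays below \<open>r < \<eta>\<close> up to some \<open>p0 > \<alpha>\<close>, and then, between 1 and \<open>p0\<close>, that it does so on the
  whole interval. This leaves room for exponents \<open>1 < a < \<alpha> < b < p \<le> p0\<close>: Potter's bounds need \<open>a\<close> and \<open>b\<close> on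
  both sides of \<open>\<alpha>\<close>, the mean of \<open>q\<close> is finite because of \<open>a > 1\<close>, and truncated moments need \<open>p > b\<close>.
\<close>

lemma truncated_generation_tail:
  fixes q :: "'s \<Rightarrow> real"
  defines "G \<equiv> \<lambda>x. \<P>(\<omega> in M. q (V [] \<omega>) > x)"
  assumes q [measurable]: "q \<in> borel_measurable S" and q_nonneg: "\<And>s. q s \<ge> 0"
    and \<alpha>: "\<alpha> > 1" and rv: "regularly_varying (-\<alpha>) G"
    and r0: "0 \<le> r0" "r0 < \<eta>" "\<eta> < 1" and \<epsilon>: "\<epsilon> > 0" and B0: "B0 \<ge> 0"
    and mean: "\<And>m. (\<integral>\<^sup>+\<omega>. ennreal (\<Sum>j\<in>{1..m}. c j (V [] \<omega>)) \<partial>M) \<le> ennreal r0"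
    and power: "\<And>m. (\<integral>\<^sup>+\<omega>. ennreal (\<Sum>j\<in>{1..m}. c j (V [] \<omega>) powr \<alpha>) \<partial>M) \<le> ennreal r0"
    and moment: "\<And>m. (\<integral>\<^sup>+\<omega>. ennreal ((\<Sum>j\<in>{1..m}. c j (V [] \<omega>)) powr (\<alpha> + \<epsilon>)) \<partial>M) \<le> ennreal B0"
  shows "\<exists>K>0. \<forall>m n. \<forall>x\<ge>1.
    emeasure M {\<omega> \<in> space M. (\<Sum>i\<in>truncated_generation m n. w i \<omega> * q (V i \<omega>)) > x} \<le>
      ennreal (K * \<eta> ^ n * G x)"
proof -
  define r where "r = (r0 + \<eta>) / 2"
  have r: "r0 < r" "0 < r" "r < \<eta>"
    using r0 by (auto simp: r_def)
  \<comment> \<open>small enough for the interpolation between \<open>r0\<close> and \<open>B0\<close> to stay below \<open>r\<close>\<close>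
  define \<theta> where "\<theta> = min 1 ((r - r0) / (B0 + 1))"
  have \<theta>: "0 < \<theta>" "\<theta> \<le> 1"
    using r B0 by (auto simp: \<theta>_def)
  have "\<theta> * B0 \<le> (r - r0) / (B0 + 1) * B0"
    using B0 by (intro mult_right_mono) (auto simp: \<theta>_def)
  also have "\<dots> \<le> r - r0"
    using r B0 by (simp add: field_simps)
  finally have "r0 + \<theta> * B0 \<le> r"
    by simp
  moreover have "(1 - \<theta>) * r0 \<le> r0"
    using \<theta> r0 by (simp add: mult_left_le_one_le)
  ultimately have \<theta>_le: "(1 - \<theta>) * r0 + \<theta> * B0 \<le> r"
    by simp
  have power_\<epsilon>: "(\<integral>\<^sup>+\<omega>. ennreal (\<Sum>j\<in>{1..m}. c j (V [] \<omega>) powr (\<alpha> + \<epsilon>)) \<partial>M) \<le> ennreal B0" for m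
  proof -
    have "(\<integral>\<^sup>+\<omega>. ennreal (\<Sum>j\<in>{1..m}. c j (V [] \<omega>) powr (\<alpha> + \<epsilon>)) \<partial>M) \<le>
        (\<integral>\<^sup>+\<omega>. ennreal ((\<Sum>j\<in>{1..m}. c j (V [] \<omega>)) powr (\<alpha> + \<epsilon>)) \<partial>M)"
      using \<alpha> \<epsilon> by (intro nn_integral_mono ennreal_leI sum_powr_le c_nonneg) auto
    then show ?thesis
      using moment[of m] by (rule order.trans)
  qed
  define p0 where "p0 = (1 - \<theta>) * \<alpha> + \<theta> * (\<alpha> + \<epsilon>)"
  have p0_eq: "p0 = \<alpha> + \<theta> * \<epsilon>"
    by (simp add: p0_def algebra_simps)
  have p0: "\<alpha> < p0" "p0 \<le> \<alpha> + \<epsilon>"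
    using \<theta> \<epsilon> by (auto simp: p0_eq mult_left_le_one_le)
  have power_p0: "(\<integral>\<^sup>+\<omega>. ennreal (\<Sum>j\<in>{1..m}. c j (V [] \<omega>) powr p0) \<partial>M) \<le> ennreal r" for m
    unfolding p0_def using \<theta> \<theta>_le r0 B0
    by (intro order.trans[OF weight_power_interpolation[OF _ _ _ _ power power_\<epsilon>]] ennreal_leI) auto
  have mean': "(\<integral>\<^sup>+\<omega>. ennreal (\<Sum>j\<in>{1..m}. c j (V [] \<omega>) powr 1) \<partial>M) \<le> ennreal r" for m
    using mean[of m] r by (auto simp: c_nonneg intro: order.trans ennreal_leI)
  have power_le: "(\<integral>\<^sup>+\<omega>. ennreal (\<Sum>j\<in>{1..m}. c j (V [] \<omega>) powr \<beta>) \<partial>M) \<le> ennreal r"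
    if \<beta>: "1 \<le> \<beta>" "\<beta> \<le> p0" for m \<beta>
  proof -
    define t where "t = (\<beta> - 1) / (p0 - 1)"
    have t: "0 \<le> t" "t \<le> 1"
      using \<beta> p0 \<alpha> by (auto simp: t_def)
    have "t * (p0 - 1) = \<beta> - 1"
      using p0 \<alpha> by (simp add: t_def)
    then have \<beta>_eq: "(1 - t) * 1 + t * p0 = \<beta>"
      by (simp add: algebra_simps)
    have "(\<integral>\<^sup>+\<omega>. ennreal (\<Sum>j\<in>{1..m}. c j (V [] \<omega>) powr ((1 - t) * 1 + t * p0)) \<partial>M) \<le>
        ennreal ((1 - t) * r + t * r)"
      using t r by (intro weight_power_interpolation mean' power_p0) auto
    then show ?thesis
      unfolding \<beta>_eq by (simp add: algebra_simps)
  qed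
  \<comment> \<open>the two bounds on \<open>\<delta>\<close> ensure \<open>p \<le> p0\<close> and \<open>a > 1\<close>\<close>
  define \<delta> where "\<delta> = min ((p0 - \<alpha>) / 2) ((\<alpha> - 1) / 2)"
  define a where "a = \<alpha> - \<delta>"
  define b where "b = \<alpha> + \<delta>"
  define p where "p = \<alpha> + 2 * \<delta>"
  have \<delta>_le: "\<delta> \<le> (p0 - \<alpha>) / 2" "\<delta> \<le> (\<alpha> - 1) / 2"
    unfolding \<delta>_def by (rule min.cobounded1, rule min.cobounded2)
  have \<delta>: "0 < \<delta>" "2 * \<delta> \<le> p0 - \<alpha>" "2 * \<delta> \<le> \<alpha> - 1"
  proof -
    show "0 < \<delta>"
      using p0 \<alpha> by (simp add: \<delta>_def)
    show "2 * \<delta> \<le> p0 - \<alpha>" "2 * \<delta> \<le> \<alpha> - 1"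
      using \<delta>_le by (simp_all only: pos_le_divide_eq zero_less_numeral mult.commute)
  qed
  have abp: "1 < a" "a < \<alpha>" "\<alpha> < b" "b < p" "p \<le> p0" "1 < p"
    using \<delta> \<alpha> by (auto simp: a_def b_def p_def)
  have G_le: "G y \<le> G x" if "x \<le> y" for x y
    unfolding G_def using that by (intro finite_measure_mono) auto
  have G_le1: "G x \<le> 1" for x
    by (simp add: G_def)
  obtain K where K: "K > 0"
    and potter: "\<forall>x\<ge>1. \<forall>c>0. G (x / c) \<le> K * G x * (c powr a + c powr b)"
    and G_upper: "\<forall>x\<ge>1. G x \<le> K * x powr (-a)"
    and G_lower: "\<forall>x\<ge>1. x powr (-b) \<le> K * G x"
    using regularly_varying_potter[OF G_le G_le1 rv, of a b] abp by auto
  have "\<exists>A>0. \<forall>x\<ge>1. \<forall>u\<ge>0. (\<integral>\<^sup>+\<omega>. ennreal (min (u * q (V [] \<omega>)) x powr p) \<partial>M) \<le>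
      ennreal (A * x powr p * \<P>(\<omega> in M. q (V [] \<omega>) > x) * (u powr a + u powr b))"
    using potter abp K unfolding G_def
    by (intro truncated_moment_le[where K = K] q_nonneg) simp_all
  then obtain A where A: "A > 0"
    and trunc: "\<forall>x\<ge>1. \<forall>u\<ge>0. (\<integral>\<^sup>+\<omega>. ennreal (min (u * q (V [] \<omega>)) x powr p) \<partial>M) \<le>
      ennreal (A * x powr p * G x * (u powr a + u powr b))"
    unfolding G_def by blast
  have "(\<integral>\<^sup>+\<omega>. ennreal (q (V [] \<omega>)) \<partial>M) < \<infinity>"
    using G_upper abp K unfolding G_def by (intro finite_mean_of_tail[where K = K and a = a]) simp_all
  then obtain \<mu> where \<mu>: "\<mu> \<ge> 0" "(\<integral>\<^sup>+\<omega>. ennreal (q (V [] \<omega>)) \<partial>M) = ennreal \<mu>"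
    by (cases "\<integral>\<^sup>+\<omega>. ennreal (q (V [] \<omega>)) \<partial>M") auto
  have moment_p: "(\<integral>\<^sup>+\<omega>. ennreal ((\<Sum>j\<in>{1..m}. c j (V [] \<omega>)) powr p) \<partial>M) \<le> ennreal (1 + B0)" for m
  proof -
    define Z where "Z \<omega> = (\<Sum>j\<in>{1..m}. c j (V [] \<omega>))" for \<omega>
    have [measurable]: "Z \<in> borel_measurable M"
      unfolding Z_def by measurable
    have "(\<integral>\<^sup>+\<omega>. ennreal (Z \<omega> powr p) \<partial>M) \<le> (\<integral>\<^sup>+\<omega>. 1 + ennreal (Z \<omega> powr (\<alpha> + \<epsilon>)) \<partial>M)"
    proof (intro nn_integral_mono)
      fix \<omega>
      have "Z \<omega> powr p \<le> 1 + Z \<omega> powr (\<alpha> + \<epsilon>)"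
        using abp p0 by (intro powr_le_one_plus) (auto simp: Z_def intro!: sum_nonneg c_nonneg)
      then have "ennreal (Z \<omega> powr p) \<le> ennreal (1 + Z \<omega> powr (\<alpha> + \<epsilon>))"
        by (rule ennreal_leI)
      then show "ennreal (Z \<omega> powr p) \<le> 1 + ennreal (Z \<omega> powr (\<alpha> + \<epsilon>))"
        by simp
    qed
    also have "\<dots> = 1 + (\<integral>\<^sup>+\<omega>. ennreal (Z \<omega> powr (\<alpha> + \<epsilon>)) \<partial>M)"
      by (simp add: nn_integral_add emeasure_space_1)
    also have "\<dots> \<le> 1 + ennreal B0"
      unfolding Z_def using moment by (intro add_left_mono)
    also have "\<dots> = ennreal (1 + B0)"
      using B0 by simp
    finally show ?thesis
      by (simp only: Z_def)
  qed
  have "\<exists>D>0. \<forall>m n.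
      (\<integral>\<^sup>+\<omega>. ennreal ((\<Sum>i\<in>truncated_generation m n. w i \<omega>) powr p) \<partial>M) \<le> ennreal (D * \<eta> ^ n)"
  proof (rule weight_sum_moment_le)
    show "(\<integral>\<^sup>+\<omega>. ennreal (\<Sum>j\<in>{1..m}. c j (V [] \<omega>)) \<partial>M) \<le> ennreal r" for m
      using mean'[of m] by (simp add: c_nonneg)
    show "(\<integral>\<^sup>+\<omega>. ennreal (\<Sum>j\<in>{1..m}. c j (V [] \<omega>) powr p) \<partial>M) \<le> ennreal r" for m
      using abp by (intro power_le) simp_all
    show "(\<integral>\<^sup>+\<omega>. ennreal ((\<Sum>j\<in>{1..m}. c j (V [] \<omega>)) powr p) \<partial>M) \<le> ennreal (1 + B0)" for m
      by (rule moment_p)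
  qed (use abp r r0 B0 in simp_all)
  then obtain D where D: "D > 0" and weight_moment: "\<forall>m n.
      (\<integral>\<^sup>+\<omega>. ennreal ((\<Sum>i\<in>truncated_generation m n. w i \<omega>) powr p) \<partial>M) \<le> ennreal (D * \<eta> ^ n)"
    by blast
  define K' where "K' = 2 * rosenthal_const p 1 * A + 2 * \<mu> powr p * D * K"
  show ?thesis
  proof (intro exI[of _ K'] conjI allI impI)
    show "K' > 0"
      unfolding K'_def using A D K rosenthal_const_pos[of p 1] abp by (intro add_pos_nonneg) auto
    fix m n and x :: real assume x: "x \<ge> 1"
    have power_\<eta>: "(\<integral>\<^sup>+\<omega>. ennreal (\<Sum>j\<in>{1..m}. c j (V [] \<omega>) powr \<beta>) \<partial>M) \<le> ennreal \<eta>"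
      if "1 \<le> \<beta>" "\<beta> \<le> p0" for m \<beta>
      by (rule order.trans[OF power_le[OF that] ennreal_leI]) (use r in simp)
    have "x powr (-p) \<le> x powr (-b)"
      using x abp by (intro powr_mono) auto
    also have "\<dots> \<le> K * G x"
      using G_lower x by simp
    finally have x_p: "x powr (-p) \<le> K * G x" .
    show "emeasure M {\<omega> \<in> space M. (\<Sum>i\<in>truncated_generation m n. w i \<omega> * q (V i \<omega>)) > x} \<le>
        ennreal (K' * \<eta> ^ n * G x)"
      unfolding K'_def
    proof (rule generation_tail_le[where a = a and b = b])
      show "(\<integral>\<^sup>+\<omega>. ennreal (min (u * q (V [] \<omega>)) x powr p) \<partial>M) \<le>
          ennreal (A * x powr p * G x * (u powr a + u powr b))" if "u \<ge> 0" for u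
        using trunc x that by blast
      show "(\<integral>\<^sup>+\<omega>. ennreal (q (V [] \<omega>)) \<partial>M) \<le> ennreal \<mu>"
        by (simp add: \<mu>)
      show "(\<integral>\<^sup>+\<omega>. ennreal ((\<Sum>i\<in>truncated_generation m n. w i \<omega>) powr p) \<partial>M) \<le> ennreal (D * \<eta> ^ n)"
        using weight_moment by blast
      show "(\<integral>\<^sup>+\<omega>. ennreal (\<Sum>j\<in>{1..m}. c j (V [] \<omega>) powr a) \<partial>M) \<le> ennreal \<eta>"
        "(\<integral>\<^sup>+\<omega>. ennreal (\<Sum>j\<in>{1..m}. c j (V [] \<omega>) powr b) \<partial>M) \<le> ennreal \<eta>" for m
        using abp by (intro power_\<eta>; simp)+
      show "0 \<le> G x"
        by (simp add: G_def)
    qed (use abp q_nonneg A \<mu>(1) D r0 x x_p in simp_all)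
  qed
qed

end

section \<open>Weighted branching trees\<close>

lemma finite_sum_le_infsum_ennreal:
  fixes f :: "'i \<Rightarrow> ennreal"
  assumes "finite F" "F \<subseteq> A"
  shows "sum f F \<le> infsum f A"
  using assms by (subst nonneg_infsum_complete) (auto intro!: SUP_upper)

lemma ennreal_less_infsumD:
  fixes f :: "'i \<Rightarrow> ennreal"
  assumes "x < infsum f A"
  obtains F where "finite F" "F \<subseteq> A" "x < sum f F"
  using assms by (subst (asm) nonneg_infsum_complete) (auto simp: less_SUP_iff)

text \<open>
  Dropping the negative part only increases the sum, also when it has the form \<open>\<infinity> - \<infinity>\<close>, whose
  value is \<open>\<infinity>\<close>; and a sum of nonnegative terms that exceeds \<open>x\<close> does so on a finite set of indices.
\<close>

lemma generation_sum_greaterD: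
  assumes x: "x \<ge> 0" and gt: "generation_sum Q N C n \<omega> > ereal x"
  obtains F where "finite F" "F \<subseteq> generation N n \<omega>"
    "x < (\<Sum>i\<in>F. max 0 (Q i \<omega> * path_weight C i \<omega>))"
proof -
  define P where "P = (\<Sum>\<^sub>\<infinity>i\<in>generation N n \<omega>. ennreal (Q i \<omega> * path_weight C i \<omega>))"
  have "enn2ereal P - enn2ereal m \<le> enn2ereal P" for m
    by (cases "enn2ereal P"; cases "enn2ereal m") (use enn2ereal_nonneg[of m] in auto)
  then have "ereal x < enn2ereal P"
    using gt unfolding generation_sum_def P_def by (rule less_le_trans[rotated])
  then have "ennreal x < P"
    using x by (simp add: less_ennreal.rep_eq enn2ereal_ennreal)
  then obtain F where F: "finite F" "F \<subseteq> generation N n \<omega>"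
      "ennreal x < (\<Sum>i\<in>F. ennreal (Q i \<omega> * path_weight C i \<omega>))"
    unfolding P_def by (rule ennreal_less_infsumD)
  have "(\<Sum>i\<in>F. ennreal (Q i \<omega> * path_weight C i \<omega>)) =
      ennreal (\<Sum>i\<in>F. max 0 (Q i \<omega> * path_weight C i \<omega>))"
    by (simp flip: sum_ennreal add: ennreal_max_0)
  then have "x < (\<Sum>i\<in>F. max 0 (Q i \<omega> * path_weight C i \<omega>))"
    using F(3) x by (simp add: ennreal_less_iff)
  then show thesis
    using that F by blast
qed

lemma generation_subset_tree_nodes: "generation N n \<omega> \<subseteq> {i \<in> tree_nodes. length i = n}"
  by (induction n) (auto simp: tree_nodes_def offspring_def subset_iff)

lemma finite_subset_truncated_generation:
  assumes "finite F" "F \<subseteq> {i \<in> tree_nodes. length i = n}"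
  obtains m where "F \<subseteq> truncated_generation m n"
proof
  define m where "m = Max (insert 0 (\<Union>(set ` F)))"
  have "k \<le> m" if "i \<in> F" "k \<in> set i" for i k
    unfolding m_def using that assms(1) by (intro Max_ge) auto
  then show "F \<subseteq> truncated_generation m n"
    using assms(2) by (fastforce simp: truncated_generation_def tree_nodes_def)
qed

lemma truncated_generation_mono:
  "m \<le> m' \<Longrightarrow> truncated_generation m n \<subseteq> truncated_generation m' n"
  by (fastforce simp: truncated_generation_def)

text \<open>
  A weight of a vector in \<open>node_space\<close> need not be nonnegative; it is almost surely so at the nodes of
  the tree. Taking the positive part gives a weight that is nonnegative everywhere.
\<close>

definition edge_weight :: "nat \<Rightarrow> real \<times> enat \<times> (nat \<Rightarrow> real) \<Rightarrow> real" where
  "edge_weight j v = max 0 (snd (snd v) j)"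

lemma edge_weight_measurable [measurable]: "edge_weight j \<in> borel_measurable node_space"
  unfolding edge_weight_def[abs_def] node_space_def by measurable

lemma fst_node_space_measurable [measurable]: "fst \<in> borel_measurable node_space"
  unfolding node_space_def by measurable

lemma iid_tree_iid_marks:
  assumes "prob_space M" "iid_tree M Q N C"
  shows "iid_marks M node_space (node_vector Q N C) edge_weight"
proof -
  interpret prob_space M by fact
  show ?thesis
    using assms(2) by unfold_locales (auto simp: iid_tree_def edge_weight_def)
qed

text \<open>
  Nonnegativity is assumed at the root only. It is a property of the law of the node vector, hence
  carries over to the countably many other nodes.
\<close>

lemma AE_offspring_weights_nonneg:
  assumes "prob_space M" "iid_tree M Q N C"
    and "AE \<omega> in M. \<forall>j\<in>offspring (N [] \<omega>). C [j] \<omega> \<ge> 0"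
  shows "AE \<omega> in M. \<forall>i\<in>tree_nodes. \<forall>j\<in>offspring (N i \<omega>). C (i @ [j]) \<omega> \<ge> 0"
proof -
  interpret iid_marks M node_space "node_vector Q N C" edge_weight
    using assms(1,2) by (rule iid_tree_iid_marks)
  define A where "A = {v \<in> space node_space. \<forall>j. snd (snd v) j \<ge> 0}"
  have A: "A \<in> sets node_space"
    unfolding A_def node_space_def by measurable
  have nonneg_iff: "node_vector Q N C i \<omega> \<in> A \<longleftrightarrow> (\<forall>j\<in>offspring (N i \<omega>). C (i @ [j]) \<omega> \<ge> 0)"
    if "i \<in> tree_nodes" "\<omega> \<in> space M" for i \<omega>
    using measurable_space[OF V_measurable that(2)] that(1)
    by (auto simp: A_def node_vector_def)
  have A_space: "{v \<in> space node_space. v \<in> A} \<in> sets node_space"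
    using A by (rule back_subst[of "\<lambda>X. X \<in> sets node_space"]) (auto simp: A_def)
  note AE_iff = AE_distr_iff[OF V_measurable A_space]
  have "AE \<omega> in M. node_vector Q N C [] \<omega> \<in> A"
    using assms(3) AE_space by eventually_elim (simp add: nonneg_iff)
  then have root: "AE v in distr M node_space (node_vector Q N C []). v \<in> A"
    by (simp only: AE_iff[OF Nil_tree_node])
  have node: "AE \<omega> in M. node_vector Q N C i \<omega> \<in> A" if "i \<in> tree_nodes" for i
    using root by (simp only: identical[OF that, symmetric] AE_iff[OF that])
  have "AE \<omega> in M. \<forall>i\<in>tree_nodes. node_vector Q N C i \<omega> \<in> A"
    using node by (intro AE_ball_countable[THEN iffD2]) auto
  then show ?thesis
    using AE_space by eventually_elim (auto simp: nonneg_iff)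
qed

lemma path_weight_eq_weight_along:
  assumes "\<forall>i\<in>tree_nodes. \<forall>j\<in>offspring (N i \<omega>). C (i @ [j]) \<omega> \<ge> 0"
    and "i \<in> generation N n \<omega>"
  shows "path_weight C i \<omega> = weight_along edge_weight (\<lambda>k. node_vector Q N C k \<omega>) i"
  using assms(2)
proof (induction n arbitrary: i)
  case (Suc n)
  then obtain k j where i: "i = k @ [j]" "k \<in> generation N n \<omega>" "j \<in> offspring (N k \<omega>)"
    by auto
  have "k \<in> tree_nodes"
    using i(2) generation_subset_tree_nodes[of N n \<omega>] by auto
  then have "edge_weight j (node_vector Q N C k \<omega>) = C (k @ [j]) \<omega>"
    using i(3) assms(1) by (simp add: edge_weight_def node_vector_def)
  then show ?case
    unfolding i(1) path_weight_snoc weight_along_snoc using Suc.IH[OF i(2)]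
    by (simp only: mult.commute)
qed simp

lemma sum_root_weights_powr_le:
  assumes "\<forall>j\<in>offspring (N [] \<omega>). C [j] \<omega> \<ge> 0"
  shows "ennreal (\<Sum>j\<in>{1..m}. edge_weight j (node_vector Q N C [] \<omega>) powr \<beta>) \<le>
    (\<Sum>\<^sub>\<infinity>j\<in>offspring (N [] \<omega>). ennreal (C [j] \<omega> powr \<beta>))"
proof -
  have "(\<Sum>j\<in>{1..m}. edge_weight j (node_vector Q N C [] \<omega>) powr \<beta>) =
      (\<Sum>j\<in>{1..m} \<inter> offspring (N [] \<omega>). C [j] \<omega> powr \<beta>)"
    using assms by (intro sum.mono_neutral_cong_right) (auto simp: edge_weight_def node_vector_def)
  then have "ennreal (\<Sum>j\<in>{1..m}. edge_weight j (node_vector Q N C [] \<omega>) powr \<beta>) =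
      (\<Sum>j\<in>{1..m} \<inter> offspring (N [] \<omega>). ennreal (C [j] \<omega> powr \<beta>))"
    by simp
  also have "\<dots> \<le> (\<Sum>\<^sub>\<infinity>j\<in>offspring (N [] \<omega>). ennreal (C [j] \<omega> powr \<beta>))"
    by (intro finite_sum_le_infsum_ennreal) auto
  finally show ?thesis .
qed

lemma sum_root_weights_le_total_weight:
  assumes "\<forall>j\<in>offspring (N [] \<omega>). C [j] \<omega> \<ge> 0"
  shows "ennreal (\<Sum>j\<in>{1..m}. edge_weight j (node_vector Q N C [] \<omega>)) \<le> total_weight N C \<omega>"
proof -
  have "edge_weight j v powr 1 = edge_weight j v" for j v
    by (simp add: edge_weight_def)
  moreover have "(\<Sum>\<^sub>\<infinity>j\<in>offspring (N [] \<omega>). ennreal (C [j] \<omega> powr 1)) = total_weight N C \<omega>"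
    unfolding total_weight_def using assms by (intro infsum_cong) simp
  ultimately show ?thesis
    using sum_root_weights_powr_le[where C = C and N = N and Q = Q and \<beta> = 1 and m = m, OF assms] by (simp only:)
qed

lemma ennreal_powr_ge:
  assumes "ennreal y \<le> z" "y \<ge> 0" "p \<ge> 0"
  shows "ennreal (y powr p) \<le> ennreal_powr z p"
proof (cases z)
  case (real r)
  then show ?thesis
    using assms by (auto simp: ennreal_powr_def intro!: ennreal_leI powr_mono2)
qed (simp add: ennreal_powr_def)

theorem proposition4p2:
  fixes M :: "'a measure"
    and Q :: "nat list \<Rightarrow> 'a \<Rightarrow> real"
    and N :: "nat list \<Rightarrow> 'a \<Rightarrow> enat"
    and C :: "nat list \<Rightarrow> 'a \<Rightarrow> real"
    and \<alpha> \<epsilon> \<eta> :: real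
  assumes "prob_space M"
    and "iid_tree M Q N C"
    and "AE \<omega> in M. \<forall>j\<in>offspring (N [] \<omega>). C [j] \<omega> \<ge> 0"
    and "\<P>(\<omega> in M. \<bar>Q [] \<omega>\<bar> > 0) > 0"
    and "\<alpha> > 1"
    and "regularly_varying (- \<alpha>) (\<lambda>x. \<P>(\<omega> in M. Q [] \<omega> > x))"
    and "\<epsilon> > 0"
    and "(\<integral>\<^sup>+\<omega>. ennreal_powr (total_weight N C \<omega>) (\<alpha> + \<epsilon>) \<partial>M) < \<infinity>"
    and "max (weight_moment M N C 1) (weight_moment M N C \<alpha>) < ennreal \<eta>"
    and "\<eta> < 1"
  shows "\<exists>K>0. \<forall>n\<ge>1. \<forall>x\<ge>1.
           \<P>(\<omega> in M. generation_sum Q N C n \<omega> > ereal x) \<le> K * \<eta> ^ n * \<P>(\<omega> in M. Q [] \<omega> > x)"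
proof -
  define V where "V = node_vector Q N C"
  interpret iid_marks M node_space V edge_weight
    unfolding V_def using assms(1,2) by (rule iid_tree_iid_marks)
  define q :: "real \<times> enat \<times> (nat \<Rightarrow> real) \<Rightarrow> real" where "q v = max 0 (fst v)" for v
  have q_measurable [measurable]: "q \<in> borel_measurable node_space"
    unfolding q_def[abs_def] by measurable
  have q_V: "q (V i \<omega>) = max 0 (Q i \<omega>)" for i \<omega>
    by (simp add: q_def V_def node_vector_def)
  have tail_eq: "\<P>(\<omega> in M. q (V [] \<omega>) > x) = \<P>(\<omega> in M. Q [] \<omega> > x)" if "x > 0" for x
    using that by (intro arg_cong[where f = "measure M"]) (auto simp: q_V)
  have rv: "regularly_varying (- \<alpha>) (\<lambda>x. \<P>(\<omega> in M. q (V [] \<omega>) > x))"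
    using assms(6) by (simp add: regularly_varying_def tail_eq)

  define \<rho> where "\<rho> = max (weight_moment M N C 1) (weight_moment M N C \<alpha>)"
  have \<rho>_less: "\<rho> < ennreal \<eta>"
    unfolding \<rho>_def by fact
  then obtain r0 where r0: "r0 \<ge> 0" "\<rho> = ennreal r0"
    by (cases \<rho>) auto
  have r0_less: "r0 < \<eta>"
    using \<rho>_less r0 by (simp add: ennreal_less_iff)
  obtain B0 where B0: "B0 \<ge> 0" "(\<integral>\<^sup>+\<omega>. ennreal_powr (total_weight N C \<omega>) (\<alpha> + \<epsilon>) \<partial>M) = ennreal B0"
    using assms(8) by (cases "\<integral>\<^sup>+\<omega>. ennreal_powr (total_weight N C \<omega>) (\<alpha> + \<epsilon>) \<partial>M") auto
  have weight_moment_ge: "(\<integral>\<^sup>+\<omega>. ennreal (\<Sum>j\<in>{1..m}. edge_weight j (V [] \<omega>) powr \<beta>) \<partial>M) \<le>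
      weight_moment M N C \<beta>" for m \<beta>
    unfolding weight_moment_def V_def
  proof (intro nn_integral_mono_AE)
    show "AE \<omega> in M. ennreal (\<Sum>j\<in>{1..m}. edge_weight j (node_vector Q N C [] \<omega>) powr \<beta>) \<le>
        (\<Sum>\<^sub>\<infinity>j\<in>offspring (N [] \<omega>). ennreal (C [j] \<omega> powr \<beta>))"
      using assms(3) by eventually_elim (rule sum_root_weights_powr_le)
  qed
  have mean: "(\<integral>\<^sup>+\<omega>. ennreal (\<Sum>j\<in>{1..m}. edge_weight j (V [] \<omega>)) \<partial>M) \<le> ennreal r0" for m
  proof -
    have "(\<Sum>j\<in>{1..m}. edge_weight j (V [] \<omega>)) = (\<Sum>j\<in>{1..m}. edge_weight j (V [] \<omega>) powr 1)" for \<omega>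
      by (simp add: c_nonneg)
    then show ?thesis
      using weight_moment_ge[of 1 m] unfolding r0(2)[symmetric] \<rho>_def
      by (simp only: max.coboundedI1)
  qed
  have power: "(\<integral>\<^sup>+\<omega>. ennreal (\<Sum>j\<in>{1..m}. edge_weight j (V [] \<omega>) powr \<alpha>) \<partial>M) \<le> ennreal r0" for m
    using weight_moment_ge[of \<alpha> m] unfolding r0(2)[symmetric] \<rho>_def by (rule max.coboundedI2)
  have moment: "(\<integral>\<^sup>+\<omega>. ennreal ((\<Sum>j\<in>{1..m}. edge_weight j (V [] \<omega>)) powr (\<alpha> + \<epsilon>)) \<partial>M) \<le> ennreal B0" for m
    unfolding B0(2)[symmetric]
  proof (intro nn_integral_mono_AE)
    show "AE \<omega> in M. ennreal ((\<Sum>j\<in>{1..m}. edge_weight j (V [] \<omega>)) powr (\<alpha> + \<epsilon>)) \<le>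
        ennreal_powr (total_weight N C \<omega>) (\<alpha> + \<epsilon>)"
      using assms(3)
    proof eventually_elim
      case (elim \<omega>)
      have "ennreal (\<Sum>j\<in>{1..m}. edge_weight j (V [] \<omega>)) \<le> total_weight N C \<omega>"
        unfolding V_def using elim by (rule sum_root_weights_le_total_weight)
      then show ?case
        using \<open>\<alpha> > 1\<close> \<open>\<epsilon> > 0\<close> by (intro ennreal_powr_ge sum_nonneg c_nonneg) simp_all
    qed
  qed

  have "\<exists>K>0. \<forall>m n. \<forall>x\<ge>1.
      emeasure M {\<omega> \<in> space M. (\<Sum>i\<in>truncated_generation m n. w i \<omega> * q (V i \<omega>)) > x} \<le>
        ennreal (K * \<eta> ^ n * \<P>(\<omega> in M. q (V [] \<omega>) > x))"
    by (rule truncated_generation_tail[OF q_measurable _ assms(5) rv r0(1) r0_less assms(10,7) B0(1)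
          mean power moment]) (simp add: q_def)
  then obtain K where K: "K > 0" and bound: "\<forall>m n. \<forall>x\<ge>1.
      emeasure M {\<omega> \<in> space M. (\<Sum>i\<in>truncated_generation m n. w i \<omega> * q (V i \<omega>)) > x} \<le>
        ennreal (K * \<eta> ^ n * \<P>(\<omega> in M. q (V [] \<omega>) > x))"
    by blast

  show ?thesis
  proof (intro exI[of _ K] conjI allI impI)
    show "K > 0" by fact
    fix n :: nat and x :: real assume x: "x \<ge> 1"
    define G where "G = \<P>(\<omega> in M. Q [] \<omega> > x)"
    define D where "D = {\<omega> \<in> space M. generation_sum Q N C n \<omega> > ereal x}"
    define E where "E m = {\<omega> \<in> space M. (\<Sum>i\<in>truncated_generation m n. w i \<omega> * q (V i \<omega>)) > x}" for m
    have [measurable]: "V i \<in> measurable M node_space" if "i \<in> truncated_generation m n" for i m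
      using that truncated_generation_subset by (intro V_measurable) auto
    have E_sets: "E m \<in> sets M" for m
      unfolding E_def by measurable
    have E_le: "emeasure M (E m) \<le> ennreal (K * \<eta> ^ n * G)" for m
      using bound x by (simp add: E_def G_def tail_eq)
    have "incseq E"
    proof (intro incseq_SucI subsetI)
      fix m \<omega> assume "\<omega> \<in> E m"
      moreover have "(\<Sum>i\<in>truncated_generation m n. w i \<omega> * q (V i \<omega>)) \<le>
          (\<Sum>i\<in>truncated_generation (Suc m) n. w i \<omega> * q (V i \<omega>))"
        by (intro sum_mono2 truncated_generation_mono) (auto simp: w_nonneg q_def)
      ultimately show "\<omega> \<in> E (Suc m)"
        by (auto simp: E_def)
    qed
    have "AE \<omega> in M. \<forall>i\<in>tree_nodes. \<forall>j\<in>offspring (N i \<omega>). C (i @ [j]) \<omega> \<ge> 0"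
      using assms(1,2,3) by (rule AE_offspring_weights_nonneg)
    then have D_subset: "AE \<omega> in M. \<omega> \<in> D \<longrightarrow> \<omega> \<in> (\<Union>m. E m)"
    proof eventually_elim
      case (elim \<omega>)
      show ?case
      proof
        assume D: "\<omega> \<in> D"
        then obtain F where F: "finite F" "F \<subseteq> generation N n \<omega>"
            "x < (\<Sum>i\<in>F. max 0 (Q i \<omega> * path_weight C i \<omega>))"
          using generation_sum_greaterD[of x Q N C n \<omega>] x by (auto simp: D_def)
        have "F \<subseteq> {i \<in> tree_nodes. length i = n}"
          using F(2) generation_subset_tree_nodes by (rule order.trans)
        with F(1) obtain m where m: "F \<subseteq> truncated_generation m n"
          by (rule finite_subset_truncated_generation)
        note F(3)
        also have "(\<Sum>i\<in>F. max 0 (Q i \<omega> * path_weight C i \<omega>)) = (\<Sum>i\<in>F. w i \<omega> * q (V i \<omega>))"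
        proof (intro sum.cong refl)
          fix i assume "i \<in> F"
          then have "i \<in> generation N n \<omega>"
            using F(2) by auto
          with elim have "path_weight C i \<omega> = weight_along edge_weight (\<lambda>k. V k \<omega>) i"
            unfolding V_def by (rule path_weight_eq_weight_along)
          then have "path_weight C i \<omega> = w i \<omega>"
            by (simp only: w_def)
          then show "max 0 (Q i \<omega> * path_weight C i \<omega>) = w i \<omega> * q (V i \<omega>)"
            using w_nonneg[of i \<omega>] by (simp add: q_V max_mult_distrib_right mult.commute[of "w i \<omega>"])
        qed
        also have "\<dots> \<le> (\<Sum>i\<in>truncated_generation m n. w i \<omega> * q (V i \<omega>))"
          using m by (intro sum_mono2) (auto simp: w_nonneg q_def)
        finally show "\<omega> \<in> (\<Union>m. E m)"
          using D by (auto simp: E_def D_def)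
      qed
    qed
    have "emeasure M D \<le> emeasure M (\<Union>m. E m)"
      using D_subset E_sets by (intro emeasure_mono_AE) auto
    also have "\<dots> = (SUP m. emeasure M (E m))"
      using E_sets \<open>incseq E\<close> by (intro SUP_emeasure_incseq[symmetric]) auto
    also have "\<dots> \<le> ennreal (K * \<eta> ^ n * G)"
      by (intro SUP_least E_le)
    finally have "emeasure M D \<le> ennreal (K * \<eta> ^ n * G)" .
    moreover have "0 \<le> K * \<eta> ^ n * G"
      using K r0(1) r0_less by (simp add: G_def)
    ultimately have "prob D \<le> K * \<eta> ^ n * G"
      by (simp add: emeasure_eq_measure)
    then show "\<P>(\<omega> in M. generation_sum Q N C n \<omega> > ereal x) \<le> K * \<eta> ^ n * \<P>(\<omega> in M. Q [] \<omega> > x)"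
      by (simp only: D_def G_def)
  qed
qed

end
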